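(* Let $0\le\alpha<\pi$, let $\nu>0$ be real, let $m\ge 1$ be an integer, and write $C_\lambda=C_\lambda^\alpha$. If $\mathcal{M}_{m,\nu}=\emptyset$, then the positive zeros of $C_\nu$ and of $R_{m-1,\nu+1}C_{\nu+m}$ are interlaced according to the pattern $$0<c_{\nu,1}<\tau_{m,\nu,1}<c_{\nu,2}<\tau_{m,\nu,2}<\cdots .$$
   Context: For real $\lambda$ and $0\le\alpha<\pi$, the cylinder function is $C_\lambda^\alpha=\cos(\alpha)\,J_\lambda-\sin(\alpha)\,Y_\lambda$ on $(0,\infty)$, where $J_\lambda$ and $Y_\lambda$ are the Bessel functions of the first and second kind of order $\lambda$; $\alpha$ is fixed and suppressed from the notation, the same $\alpha$ being used for all orders. $\{c_{\lambda,k}\}_{k=1}^\infty$ is the sequence of all positive zeros of $C_\lambda$ in increasing order. For a nonnegative integer $n$ and real $\lambda>0$, the Lommel polynomial (a polynomial in $1/x$) is $$R_{n,\lambda}(x)=\sum_{k=0}^{\lfloor n/2\rfloor}(-1)^k\binom{n-k}{k}\frac{\Gamma(\lambda+n-k)}{\Gamma(\lambda+k)}\left(\frac{x}{2}\right)^{2k-n},\qquad x>0.$$ $\mathcal{M}_{m,\nu}=\{c_{\nu,k}: k\ge 1,\ C_{\nu+m}(c_{\nu,k})=0\}$ is the set of positive zeros common to $C_\nu$ and $C_{\nu+m}$. The sequence $\{\tau_{m,\nu,k}\}_{k=1}^\infty$ is the increasing enumeration of the set $\{x>0: C_{\nu+m}(x)=0\}\cup\{x>0: R_{m-1,\nu+1}(x)=0\}$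 (a set union, each element listed once). *)

theory Defs
  imports "HOL-Analysis.Analysis"
begin

text \<open>For \<open>x > 0\<close> and arbitrary real order. The library's reciprocal Gamma function \<open>rGamma\<close>
  vanishes at the poles of \<open>Gamma\<close>, so negative integer orders are covered.\<close>

definition bessel_J :: "real \<Rightarrow> real \<Rightarrow> real" where
  "bessel_J \<mu> x =
     (\<Sum>k. (-1) ^ k / fact k * rGamma (\<mu> + real k + 1) * (x / 2) powr (2 * real k + \<mu>))"

definition bessel_Y_quot :: "real \<Rightarrow> real \<Rightarrow> real" where
  "bessel_Y_quot \<mu> x = (bessel_J \<mu> x * cos (\<mu> * pi) - bessel_J (- \<mu>) x) / sin (\<mu> * pi)"

definition bessel_Y :: "real \<Rightarrow> real \<Rightarrow> real" where
  "bessel_Y \<mu> x =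
     (if \<mu> \<in> \<int> then Lim (at \<mu>) (\<lambda>\<xi>. bessel_Y_quot \<xi> x) else bessel_Y_quot \<mu> x)"

definition cylinder :: "real \<Rightarrow> real \<Rightarrow> real \<Rightarrow> real" where
  "cylinder \<alpha> \<mu> x = cos \<alpha> * bessel_J \<mu> x - sin \<alpha> * bessel_Y \<mu> x"

definition lommel_R :: "nat \<Rightarrow> real \<Rightarrow> real \<Rightarrow> real" where
  "lommel_R n \<mu> x =
     (\<Sum>k = 0..n div 2. (-1) ^ k * real ((n - k) choose k)
        * (Gamma (\<mu> + real n - real k) / Gamma (\<mu> + real k))
        * (x / 2) powi (2 * int k - int n))"

text \<open>The increasing enumeration of a set of reals of order type \<open>\<omega>\<close>, indexed from 0;
  unspecified for all other sets.\<close>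

definition incr_enum :: "real set \<Rightarrow> nat \<Rightarrow> real" where
  "incr_enum S = (THE f. strict_mono f \<and> range f = S)"

lemma incr_enum_eqI:
  assumes f: "strict_mono f" "range f = S"
  shows "incr_enum S = f"
proof -
  have le: "p n \<le> q n"
    if p: "strict_mono p" and q: "strict_mono q" and r: "range q = range p"
    for p q :: "nat \<Rightarrow> real" and n
  proof -
    have "\<forall>k. \<exists>j. q k = p j" using r by (metis rangeE rangeI)
    then obtain h where h: "\<And>k. q k = p (h k)" by metis
    have "strict_mono h"
      using p q by (auto simp: strict_mono_def h strict_mono_less[OF p])
    then have "n \<le> h n" by (rule strict_mono_imp_increasing)
    then show ?thesis using p by (simp add: h strict_mono_less_eq)
  qed
  show ?thesis unfolding incr_enum_def
  proof (rule the_equality)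
    fix g :: "nat \<Rightarrow> real" assume g: "strict_mono g \<and> range g = S"
    show "g = f"
    proof
      fix n
      show "g n = f n" using le[of g f n] le[of f g n] f g by force
    qed
  qed (use f in simp)
qed

text \<open>\<open>cylinder_zero\<close> and \<open>tau\<close> are sequences indexed by \<open>k \<ge> 1\<close>.\<close>

definition cylinder_zero :: "real \<Rightarrow> real \<Rightarrow> nat \<Rightarrow> real" where
  "cylinder_zero \<alpha> \<mu> k = incr_enum {x. x > 0 \<and> cylinder \<alpha> \<mu> x = 0} (k - 1)"

definition common_zeros :: "real \<Rightarrow> nat \<Rightarrow> real \<Rightarrow> real set" where
  "common_zeros \<alpha> m \<nu> =
     {cylinder_zero \<alpha> \<nu> k | k. k \<ge> 1 \<and> cylinder \<alpha> (\<nu> + real m) (cylinder_zero \<alpha> \<nu> k) = 0}"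

definition tau :: "real \<Rightarrow> nat \<Rightarrow> real \<Rightarrow> nat \<Rightarrow> real" where
  "tau \<alpha> m \<nu> k =
     incr_enum ({x. x > 0 \<and> cylinder \<alpha> (\<nu> + real m) x = 0}
                \<union> {x. x > 0 \<and> lommel_R (m - 1) (\<nu> + 1) x = 0}) (k - 1)"

end

theory Submission
  imports Defs "HOL-Real_Asymp.Real_Asymp"
begin

text \<open>
  Put \<open>P\<^sub>j = C\<^bsub>\<nu>+j\<^esub>\<close> and \<open>Q\<^sub>j = R\<^bsub>j-1,\<nu>+1\<^esub>\<close> with \<open>Q\<^sub>0 = 0\<close>. In \<open>j\<close> both satisfy the same three-term
  recurrence, so the Casoratian \<open>P\<^sub>j Q\<^bsub>j+1\<^esub> - P\<^bsub>j+1\<^esub> Q\<^sub>j\<close> is constant, equal to \<open>P\<^sub>0 = C\<^sub>\<nu>\<close>. Together with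
  \<open>P\<^sub>m' = P\<^bsub>m-1\<^esub> - (\<nu>+m)/x P\<^sub>m\<close> and the negativity of the Wronskian of \<open>Q\<^bsub>m-1\<^esub>, Q\<^sub>m\<close> in \<open>x\<close>, this shows that
  at each zero of \<open>G = P\<^sub>m Q\<^sub>m\<close> where \<open>P\<^sub>0 \<noteq> 0\<close> the derivative \<open>G'\<close> has the sign of \<open>P\<^sub>0\<close>. Hence \<open>G\<close>
  has at most one zero between consecutive zeros of \<open>C\<^sub>\<nu>\<close>, and none before the first one, because
  \<open>C\<^sub>\<nu>\<close> and \<open>G\<close> are positive near \<open>0\<close>. At a zero of \<open>C\<^sub>\<nu>\<close> one has \<open>P\<^sub>m = C\<^bsub>\<nu>+1\<^esub> Q\<^sub>m\<close> and
  \<open>C\<^sub>\<nu>' = - C\<^bsub>\<nu>+1\<^esub>\<close>, so \<open>G\<close> is of opposite sign to \<open>C\<^sub>\<nu>'\<close> there, which forces a zero of \<open>G\<close> in between.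
\<close>

subsection \<open>The power series of the Bessel functions\<close>

lemma has_real_derivative_rGamma:
  "(rGamma has_field_derivative deriv rGamma z) (at (z::real))"
  using has_field_derivative_rGamma DERIV_imp_deriv by metis

lemma rGamma_recur_deriv:
  fixes z :: real
  shows "deriv rGamma z = rGamma (z + 1) + z * deriv rGamma (z + 1)"
proof -
  have "((\<lambda>z. rGamma (z + 1)) has_field_derivative deriv rGamma (z + 1)) (at z)"
    using has_real_derivative_rGamma[of "z + 1"] by (simp add: DERIV_shift)
  then have "((\<lambda>z. z * rGamma (z + 1)) has_field_derivative rGamma (z + 1) + z * deriv rGamma (z + 1)) (at z)"
    using DERIV_mult[OF DERIV_ident, of "\<lambda>z. rGamma (z + 1)" "deriv rGamma (z + 1)" z UNIV]
    by (simp add: mult.commute)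
  then have "(rGamma has_field_derivative rGamma (z + 1) + z * deriv rGamma (z + 1)) (at z)"
    by (simp add: rGamma_plus1)
  then show ?thesis by (rule DERIV_imp_deriv)
qed

text \<open>Compactness bounds both functions on [1, 2]. Each unit step of the recurrence divides by
  \<open>w \<ge> 1\<close>, so \<open>rGamma\<close> does not grow in absolute value and its
  derivative gains at most \<open>M\<close>, which gives linear growth.\<close>

lemma rGamma_bounds:
  obtains M where "M \<ge> 0"
    "\<And>z::real. z \<ge> 1 \<Longrightarrow> \<bar>rGamma z\<bar> \<le> M \<and> \<bar>deriv rGamma z\<bar> \<le> M * z"
proof -
  have nn: "z \<notin> \<int>\<^sub>\<le>\<^sub>0" if "z \<ge> 1" for z :: real
    using that by (auto elim!: nonpos_Ints_cases)
  have "continuous_on {1..2::real} (\<lambda>z. - rGamma z * Digamma z)"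
    by (intro continuous_intros continuous_on_Polygamma) (use nn in auto)
  moreover have "deriv rGamma z = - rGamma z * Digamma z" if "z \<in> {1..2}" for z :: real
    using that nn by (intro DERIV_imp_deriv has_field_derivative_rGamma_no_nonpos_int) auto
  ultimately have c: "continuous_on {1..2::real} (deriv rGamma)"
    using continuous_on_cong[of "{1..2}" "{1..2}" "deriv rGamma" "\<lambda>z::real. - rGamma z * Digamma z"] by blast
  obtain M1 where M1: "\<forall>w \<in> rGamma ` {1..2::real}. norm w \<le> M1"
    using compact_imp_bounded[OF compact_continuous_image[OF continuous_on_rGamma compact_Icc]]
    unfolding bounded_iff by blast
  obtain M2 where M2: "\<forall>w \<in> deriv rGamma ` {1..2::real}. norm w \<le> M2"
    using compact_imp_bounded[OF compact_continuous_image[OF c compact_Icc]]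
    unfolding bounded_iff by blast
  define M where "M = max 0 (max M1 M2)"
  have M: "M \<ge> 0" "M1 \<le> M" "M2 \<le> M" by (auto simp: M_def)
  \<comment> \<open>The induction on \<open>n\<close> extends the bounds from [1, n + 2] to
    [1, n + 3].\<close>
  have *: "\<bar>rGamma z\<bar> \<le> M \<and> \<bar>deriv rGamma z\<bar> \<le> M * z" if "1 \<le> z" "z \<le> 2 + real n" for z n
    using that
  proof (induction n arbitrary: z)
    case 0
    then have "\<bar>rGamma z\<bar> \<le> M" "\<bar>deriv rGamma z\<bar> \<le> M"
      using M1 M2 M by force+
    moreover have "M \<le> M * z" using 0 M(1) mult_left_mono[of 1 z M] by simp
    ultimately show ?case by linarith
  next
    case (Suc n)
    show ?case
    proof (cases "z \<le> 2 + real n")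
      case True
      then show ?thesis using Suc by blast
    next
      case False
      define w where "w = z - 1"
      have w: "1 \<le> w" "w \<le> 2 + real n" "z = w + 1" using False Suc.prems by (auto simp: w_def)
      have IH: "\<bar>rGamma w\<bar> \<le> M" "\<bar>deriv rGamma w\<bar> \<le> M * w" using Suc.IH[OF w(1,2)] by auto
      have "rGamma z = rGamma w / w" using rGamma_plus1[of w] w by (simp add: field_simps)
      then have a: "\<bar>rGamma z\<bar> \<le> \<bar>rGamma w\<bar>"
        using w mult_left_mono[of 1 w "\<bar>rGamma w\<bar>"]
        by (simp add: pos_divide_le_eq flip: abs_div_pos)
      have "deriv rGamma z = (deriv rGamma w - rGamma z) / w"
        using rGamma_recur_deriv[of w] w by (simp add: field_simps)
      moreover have "\<bar>(deriv rGamma w - rGamma z) / w\<bar> \<le> \<bar>deriv rGamma w - rGamma z\<bar>"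
        using w mult_left_mono[of 1 w "\<bar>deriv rGamma w - rGamma z\<bar>"]
        by (simp add: pos_divide_le_eq flip: abs_div_pos)
      ultimately have "\<bar>deriv rGamma z\<bar> \<le> M * z"
        using IH a w by (simp add: algebra_simps)
      with a IH show ?thesis by linarith
    qed
  qed
  show thesis
  proof (rule that[OF M(1)])
    fix z :: real assume "z \<ge> 1"
    obtain n where "z \<le> real n" using real_arch_simple by blast
    then have "z \<le> 2 + real n" by simp
    with \<open>z \<ge> 1\<close> show "\<bar>rGamma z\<bar> \<le> M \<and> \<bar>deriv rGamma z\<bar> \<le> M * z" by (rule *)
  qed
qed

text \<open>The entire factor of the Bessel function: \<open>bessel_J \<mu> x\<close> is
  \<open>(x / 2) powr \<mu>\<close> times its value at \<open>(x / 2)\<^sup>2\<close>. With the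
  power split off, termwise differentiation applies both in \<open>y\<close> and in the
  order.\<close>

definition bessel_F :: "real \<Rightarrow> real \<Rightarrow> real" where
  "bessel_F \<mu> y = (\<Sum>k. (-1) ^ k / fact k * rGamma (\<mu> + real k + 1) * y ^ k)"

text \<open>A prime on a Bessel function denotes the derivative with respect to the order.\<close>

definition bessel_F' :: "real \<Rightarrow> real \<Rightarrow> real" where
  "bessel_F' \<mu> y = (\<Sum>k. (-1) ^ k / fact k * deriv rGamma (\<mu> + real k + 1) * y ^ k)"

text \<open>Once \<open>k \<ge> \<bar>a\<bar>\<close>, every argument \<open>\<mu> + k + 1\<close>
  is at least 1, so \<open>rGamma_bounds\<close> applies. The linear growth in \<open>k\<close> is
  absorbed by \<open>2 ^ k\<close>, leaving an exponential series in
  \<open>2 * \<bar>y\<bar>\<close>. For the derivative terms the bound is uniform in the order, as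
  the Weierstrass M-test requires.\<close>

lemma bessel_F_terms_bound:
  fixes a y :: real
  obtains B :: "nat \<Rightarrow> real" where "summable B"
    "\<And>\<mu>. \<bar>\<mu>\<bar> \<le> a \<Longrightarrow> eventually (\<lambda>k. \<bar>(-1) ^ k / fact k * rGamma (\<mu> + real k + 1) * y ^ k\<bar> \<le> B k) sequentially"
    "eventually (\<lambda>k. \<forall>\<mu>\<in>{-a..a}. \<bar>(-1) ^ k / fact k * deriv rGamma (\<mu> + real k + 1) * y ^ k\<bar> \<le> B k) sequentially"
proof -
  obtain M where M: "M \<ge> 0"
    "\<And>z::real. z \<ge> 1 \<Longrightarrow> \<bar>rGamma z\<bar> \<le> M \<and> \<bar>deriv rGamma z\<bar> \<le> M * z"
    by (rule rGamma_bounds) blast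
  define B where "B = (\<lambda>k. M * (\<bar>a\<bar> + 2) * ((2 * \<bar>y\<bar>) ^ k / fact k))"
  have "summable (\<lambda>k. M * (\<bar>a\<bar> + 2) * (inverse (fact k) * (2 * \<bar>y\<bar>) ^ k))"
    by (intro summable_mult summable_exp)
  then have s: "summable B" by (simp add: B_def field_simps)
  have key: "\<bar>(-1) ^ k / fact k * rGamma (\<mu> + real k + 1) * y ^ k\<bar> \<le> B k \<and>
     \<bar>(-1) ^ k / fact k * deriv rGamma (\<mu> + real k + 1) * y ^ k\<bar> \<le> B k"
    if k: "real k \<ge> \<bar>a\<bar>" and \<mu>: "\<bar>\<mu>\<bar> \<le> a" for k \<mu>
  proof -
    have z: "\<mu> + real k + 1 \<ge> 1" using k \<mu> by linarith
    have k2: "1 + real k \<le> 2 ^ k"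
    proof -
      have "Suc k \<le> 2 ^ k" by (simp add: Suc_leI less_exp)
      then have "real (Suc k) \<le> real (2 ^ k)" by (rule of_nat_mono)
      then show ?thesis by simp
    qed
    have "\<mu> + real k + 1 \<le> (\<bar>a\<bar> + 2) * (1 + real k)"
    proof -
      have "0 \<le> \<bar>a\<bar> * real k" by simp
      moreover have "(\<bar>a\<bar> + 2) * (1 + real k) = \<bar>a\<bar> + \<bar>a\<bar> * real k + 2 + 2 * real k"
        by (simp add: algebra_simps)
      ultimately show ?thesis using \<mu> k by linarith
    qed
    also have "\<dots> \<le> (\<bar>a\<bar> + 2) * 2 ^ k" using k2 by (intro mult_left_mono) auto
    finally have zz: "M * (\<mu> + real k + 1) \<le> M * ((\<bar>a\<bar> + 2) * 2 ^ k)" by (rule mult_left_mono) (rule M)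
    have one: "M \<le> M * (\<mu> + real k + 1)" using z M(1) mult_left_mono[of 1 "\<mu> + real k + 1" M] by simp
    have gen: "\<bar>(-1) ^ k / fact k * u * y ^ k\<bar> \<le> B k" if "\<bar>u\<bar> \<le> M * ((\<bar>a\<bar> + 2) * 2 ^ k)" for u
    proof -
      have "\<bar>(-1) ^ k / fact k * u * y ^ k\<bar> = \<bar>u\<bar> * (\<bar>y\<bar> ^ k / fact k)"
        by (simp add: abs_mult power_abs)
      also have "\<dots> \<le> M * ((\<bar>a\<bar> + 2) * 2 ^ k) * (\<bar>y\<bar> ^ k / fact k)"
        using that by (intro mult_right_mono) auto
      also have "\<dots> = B k" by (simp add: B_def power_mult_distrib)
      finally show ?thesis .
    qed
    show ?thesis using M(2)[OF z] one zz by (intro conjI gen) linarith+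
  qed
  have ev: "eventually (\<lambda>k. real k \<ge> \<bar>a\<bar>) sequentially"
    using filterlim_real_sequentially by (auto simp: filterlim_at_top)
  show thesis
  proof (rule that[OF s])
    show "eventually (\<lambda>k. \<bar>(-1) ^ k / fact k * rGamma (\<mu> + real k + 1) * y ^ k\<bar> \<le> B k) sequentially"
      if "\<bar>\<mu>\<bar> \<le> a" for \<mu>
      by (rule eventually_mono[OF ev]) (rule key[THEN conjunct1, OF _ that])
    show "eventually (\<lambda>k. \<forall>\<mu>\<in>{-a..a}. \<bar>(-1) ^ k / fact k * deriv rGamma (\<mu> + real k + 1) * y ^ k\<bar> \<le> B k) sequentially"
      by (rule eventually_mono[OF ev], rule ballI, rule key[THEN conjunct2]) (simp_all add: abs_le_iff)
  qed
qed

lemma summable_bessel_F: "summable (\<lambda>k. (-1) ^ k / fact k * rGamma (\<mu> + real k + 1) * y ^ k)"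
proof -
  obtain B where B: "summable B"
    "\<And>\<nu>. \<bar>\<nu>\<bar> \<le> \<bar>\<mu>\<bar> \<Longrightarrow> eventually (\<lambda>k. \<bar>(-1) ^ k / fact k * rGamma (\<nu> + real k + 1) * y ^ k\<bar> \<le> B k) sequentially"
    by (rule bessel_F_terms_bound[of "\<bar>\<mu>\<bar>" y]) blast
  show ?thesis
    by (rule summable_comparison_test_ev[OF _ B(1)]) (use B(2)[of \<mu>] in simp)
qed

lemma summable_bessel_F': "summable (\<lambda>k. (-1) ^ k / fact k * deriv rGamma (\<mu> + real k + 1) * y ^ k)"
proof -
  obtain B where B: "summable B"
    "eventually (\<lambda>k. \<forall>\<nu>\<in>{-\<bar>\<mu>\<bar>..\<bar>\<mu>\<bar>}. \<bar>(-1) ^ k / fact k * deriv rGamma (\<nu> + real k + 1) * y ^ k\<bar> \<le> B k) sequentially"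
    by (rule bessel_F_terms_bound[of "\<bar>\<mu>\<bar>" y]) blast
  show ?thesis
    by (rule summable_comparison_test_ev[OF _ B(1)], rule eventually_mono[OF B(2)]) (auto dest!: bspec[of _ _ \<mu>])
qed

text \<open>Termwise differentiation: the differentiated series converges uniformly in the order by
  the M-test. The interval is widened by 1 so that \<open>\<mu>\<close> is an interior
  point.\<close>

lemma bessel_F_has_derivative_order:
  "((\<lambda>\<mu>. bessel_F \<mu> y) has_field_derivative bessel_F' \<mu> y) (at \<mu>)"
proof -
  define a where "a = \<bar>\<mu>\<bar> + 1"
  obtain B where B: "summable B"
    "eventually (\<lambda>k. \<forall>\<nu>\<in>{-a..a}. \<bar>(-1) ^ k / fact k * deriv rGamma (\<nu> + real k + 1) * y ^ k\<bar> \<le> B k) sequentially"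
    by (rule bessel_F_terms_bound[of a y]) blast
  show ?thesis unfolding bessel_F_def bessel_F'_def
  proof (rule has_field_derivative_series'(2)[where S = "{-a..a}" and ?x0.0 = \<mu>])
    show "uniformly_convergent_on {- a..a}
     (\<lambda>n x. \<Sum>i<n. (- 1) ^ i / fact i * deriv rGamma (x + real i + 1) * y ^ i)"
      by (rule Weierstrass_m_test'_ev[OF _ B(1)]) (use B(2) in simp)
    show "\<mu> \<in> {-a..a}" "\<mu> \<in> interior {-a..a}" by (auto simp: a_def)
    show "summable (\<lambda>n. (- 1) ^ n / fact n * rGamma (\<mu> + real n + 1) * y ^ n)"
      by (rule summable_bessel_F)
    show "((\<lambda>\<mu>. (- 1) ^ n / fact n * rGamma (\<mu> + real n + 1) * y ^ n) has_field_derivative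
            (- 1) ^ n / fact n * deriv rGamma (x + real n + 1) * y ^ n) (at x within {- a..a})" for n x
    proof -
      have "((\<lambda>\<mu>. rGamma (\<mu> + (real n + 1))) has_field_derivative deriv rGamma (x + (real n + 1))) (at x)"
        using has_real_derivative_rGamma[of "x + (real n + 1)"] by (simp only: DERIV_shift)
      from DERIV_cmult_right[OF DERIV_cmult[OF this, of "(- 1) ^ n / fact n"], of "y ^ n"] show ?thesis
        unfolding add.assoc[symmetric] by (rule has_field_derivative_at_within)
    qed
  qed simp
qed

text \<open>Differentiating a power series shifts its index, which here amounts to raising the order
  by 1. The arbitrary \<open>g\<close> covers both \<open>rGamma\<close> and its derivative.\<close>

lemma bessel_coeff_diffs:
  "diffs (\<lambda>k. (-1) ^ k / fact k * g (\<mu> + real k + 1)) n = - ((-1) ^ n / fact n * g (\<mu> + 1 + real n + 1) :: real)"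
proof -
  have e: "\<mu> + real (Suc n) + 1 = \<mu> + 1 + real n + 1" by simp
  show ?thesis unfolding diffs_def e by (simp del: of_nat_Suc add: fact_Suc)
qed

lemma bessel_F_has_derivative:
  "((\<lambda>y. bessel_F \<mu> y) has_field_derivative - bessel_F (\<mu> + 1) y) (at y)"
  using termdiffs_strong_converges_everywhere[OF summable_bessel_F, of \<mu> y]
  unfolding bessel_coeff_diffs[where g = rGamma] mult_minus_left suminf_minus[OF summable_bessel_F] bessel_F_def[symmetric] .

lemma bessel_F'_has_derivative:
  "((\<lambda>y. bessel_F' \<mu> y) has_field_derivative - bessel_F' (\<mu> + 1) y) (at y)"
  using termdiffs_strong_converges_everywhere[OF summable_bessel_F', of \<mu> y]
  unfolding bessel_coeff_diffs[where g = "deriv rGamma"] mult_minus_left suminf_minus[OF summable_bessel_F'] bessel_F'_def[symmetric] .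

text \<open>Coefficient comparison from
  \<open>rGamma (\<mu> + k) = (\<mu> + k) * rGamma (\<mu> + k + 1)\<close>: the summand
  \<open>\<mu>\<close> yields the first series, the summand \<open>k\<close> cancels against the
  factorial and yields the second.\<close>

lemma bessel_F_recur: "bessel_F (\<mu> - 1) y = \<mu> * bessel_F \<mu> y - y * bessel_F (\<mu> + 1) y"
proof -
  let ?t = "\<lambda>\<mu> k. (-1) ^ k / fact k * rGamma (\<mu> + real k + 1) * y ^ k"
  have s: "?t \<mu> sums bessel_F \<mu> y" for \<mu>
    unfolding bessel_F_def by (rule summable_sums[OF summable_bessel_F])
  have "(\<lambda>k. \<mu> * ?t \<mu> k) sums (\<mu> * bessel_F \<mu> y)" by (rule sums_mult[OF s])
  \<comment> \<open>A zero term in front aligns the powers of \<open>y\<close> after multiplication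
    by \<open>y\<close>.\<close>
  moreover have "(\<lambda>k. case k of 0 \<Rightarrow> 0 | Suc k \<Rightarrow> - (y * ?t (\<mu> + 1) k)) sums (- (y * bessel_F (\<mu> + 1) y))"
    using sums_Suc[of "\<lambda>k. case k of 0 \<Rightarrow> 0 | Suc k \<Rightarrow> - (y * ?t (\<mu> + 1) k)" "- (y * bessel_F (\<mu> + 1) y)"]
      sums_minus[OF sums_mult[OF s[of "\<mu> + 1"], of y]] by (simp only: nat.case add_0_right)
  ultimately have "(\<lambda>k. \<mu> * ?t \<mu> k + (case k of 0 \<Rightarrow> 0 | Suc k \<Rightarrow> - (y * ?t (\<mu> + 1) k)))
      sums (\<mu> * bessel_F \<mu> y + - (y * bessel_F (\<mu> + 1) y))" by (rule sums_add)
  moreover have "\<mu> * ?t \<mu> k + (case k of 0 \<Rightarrow> 0 | Suc k \<Rightarrow> - (y * ?t (\<mu> + 1) k)) = ?t (\<mu> - 1) k" for k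
  proof (cases k)
    case 0
    then show ?thesis using rGamma_plus1[of \<mu>] by simp
  next
    case (Suc j)
    have a: "rGamma (\<mu> + real k) = (\<mu> + real k) * rGamma (\<mu> + real k + 1)" by (simp add: rGamma_plus1)
    have b: "\<mu> + 1 + real j + 1 = \<mu> + real k + 1" "\<mu> - 1 + real k + 1 = \<mu> + real k" using Suc by auto
    have c: "- (y * ((-1) ^ j / fact j * r * y ^ j)) = real k * ((-1) ^ k / fact k * r * y ^ k)" for r
      using Suc by (simp add: fact_Suc del: of_nat_Suc)
    show ?thesis unfolding b(2) a using c[of "rGamma (\<mu> + real k + 1)"] b(1)
      by (simp only: Suc nat.case) (simp only: distrib_right distrib_left mult.assoc mult.left_commute)
  qed
  ultimately show ?thesis using s[of "\<mu> - 1"] sums_unique2 by fastforce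
qed

text \<open>The derivative of \<open>bessel_F_recur\<close> with respect to the order.\<close>

lemma bessel_F'_recur:
  "bessel_F' (\<mu> - 1) y = bessel_F \<mu> y + \<mu> * bessel_F' \<mu> y - y * bessel_F' (\<mu> + 1) y"
proof (rule DERIV_unique)
  have *: "((\<lambda>\<mu>. bessel_F (\<mu> + c) y) has_field_derivative bessel_F' (\<mu> + c) y) (at \<mu>)" for c
    using bessel_F_has_derivative_order[of y "\<mu> + c"] by (simp add: DERIV_shift)
  show "((\<lambda>\<mu>. bessel_F (\<mu> - 1) y) has_field_derivative bessel_F' (\<mu> - 1) y) (at \<mu>)"
    using *[of "-1"] by simp
  show "((\<lambda>\<mu>. bessel_F (\<mu> - 1) y) has_field_derivative
      bessel_F \<mu> y + \<mu> * bessel_F' \<mu> y - y * bessel_F' (\<mu> + 1) y) (at \<mu>)"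
    unfolding bessel_F_recur
    by (auto intro!: derivative_eq_intros bessel_F_has_derivative_order *)
qed

text \<open>\<open>rGamma\<close> vanishes at the nonpositive integers, so the first
  \<open>n\<close> terms drop out and the rest is a shifted series of order
  \<open>n\<close>.\<close>

lemma bessel_F_neg_nat: "bessel_F (- real n) y = (- y) ^ n * bessel_F (real n) y"
proof -
  let ?t = "\<lambda>k. (-1) ^ k / fact k * rGamma (- real n + real k + 1) * y ^ k"
  have z: "?t k = 0" if "k < n" for k
  proof -
    have "- real n + real k + 1 = - real (n - Suc k)" using that by (simp add: of_nat_diff)
    then have "rGamma (- real n + real k + 1) = 0"
      by (simp only: rGamma_eq_zero_iff nonpos_Ints_altdef) (auto intro!: exI)
    then show ?thesis by simp
  qed
  have "?t (k + n) = (- y) ^ n * ((-1) ^ k / fact k * rGamma (real n + real k + 1) * y ^ k)" for k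
  proof -
    have a: "rGamma (real k + 1) = inverse (fact k)"
      using Gamma_fact[of k, where 'a = real] by (simp add: rGamma_inverse_Gamma add.commute)
    have b: "rGamma (real n + real k + 1) = inverse (fact (n + k))"
      using Gamma_fact[of "n + k", where 'a = real] by (simp add: rGamma_inverse_Gamma add.commute)
    have "- real n + real (k + n) + 1 = real k + 1" by simp
    then show ?thesis by (simp only: a b) (simp add: field_simps power_add power_minus[of y])
  qed
  then have "(\<lambda>k. ?t (k + n)) sums ((- y) ^ n * bessel_F (real n) y)"
    unfolding bessel_F_def by (simp only:) (rule sums_mult[OF summable_sums[OF summable_bessel_F]])
  then have "?t sums ((- y) ^ n * bessel_F (real n) y)"
    using z by (subst (asm) sums_zero_iff_shift) auto
  then show ?thesis unfolding bessel_F_def using sums_unique by fastforce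
qed

subsection \<open>Cylinder functions\<close>

lemma bessel_J_eq:
  assumes "x > 0"
  shows "bessel_J \<mu> x = (x / 2) powr \<mu> * bessel_F \<mu> ((x / 2)\<^sup>2)"
proof -
  have "(x / 2) powr (2 * real k + \<mu>) = (x / 2) powr \<mu> * ((x / 2)\<^sup>2) ^ k" for k
    using assms powr_realpow[of "x / 2" "2 * k"] by (simp add: powr_add power_mult)
  then have "bessel_J \<mu> x = (\<Sum>k. (x / 2) powr \<mu> *
      ((-1) ^ k / fact k * rGamma (\<mu> + real k + 1) * ((x / 2)\<^sup>2) ^ k))"
    unfolding bessel_J_def by (simp only: mult_ac)
  also have "\<dots> = (x / 2) powr \<mu> * bessel_F \<mu> ((x / 2)\<^sup>2)"
    unfolding bessel_F_def by (rule suminf_mult[OF summable_bessel_F])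
  finally show ?thesis .
qed

definition bessel_J' :: "real \<Rightarrow> real \<Rightarrow> real" where
  "bessel_J' \<mu> x = (x / 2) powr \<mu> *
     (ln (x / 2) * bessel_F \<mu> ((x / 2)\<^sup>2) + bessel_F' \<mu> ((x / 2)\<^sup>2))"

lemma bessel_J_has_derivative_order:
  assumes "x > 0"
  shows "((\<lambda>\<mu>. bessel_J \<mu> x) has_field_derivative bessel_J' \<mu> x) (at \<mu>)"
  unfolding bessel_J_eq[OF assms] bessel_J'_def using assms
  by (auto intro!: derivative_eq_intros bessel_F_has_derivative_order simp: algebra_simps)

lemma half_powr_has_derivative:
  fixes x :: real
  assumes "x > 0"
  shows "((\<lambda>x. (x / 2) powr \<mu>) has_field_derivative \<mu> / x * (x / 2) powr \<mu>) (at x)"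
  using assms by (auto intro!: derivative_eq_intros simp: powr_diff)

lemma bessel_J_has_derivative:
  assumes "x > 0"
  shows "(bessel_J \<mu> has_field_derivative \<mu> / x * bessel_J \<mu> x - bessel_J (\<mu> + 1) x) (at x)"
proof (rule has_field_derivative_transform_within_open[where S = "{0<..}"])
  have y: "((\<lambda>x. (x / 2)\<^sup>2) has_field_derivative x / 2) (at x)"
    by (auto intro!: derivative_eq_intros)
  show "((\<lambda>x. (x / 2) powr \<mu> * bessel_F \<mu> ((x / 2)\<^sup>2)) has_field_derivative
      \<mu> / x * bessel_J \<mu> x - bessel_J (\<mu> + 1) x) (at x)"
    by (rule DERIV_cong[OF DERIV_mult[OF half_powr_has_derivative[OF assms]
          DERIV_chain2[OF bessel_F_has_derivative y]]])
      (use assms in \<open>simp add: bessel_J_eq powr_add algebra_simps\<close>)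
qed (use assms bessel_J_eq in auto)

text \<open>The order derivative of the formula in \<open>bessel_J_has_derivative\<close>; the extra
  term \<open>bessel_J \<mu> x / x\<close> arises from the logarithm in
  \<open>bessel_J'\<close>.\<close>

lemma bessel_J'_has_derivative:
  assumes "x > 0"
  shows "(bessel_J' \<mu> has_field_derivative
    \<mu> / x * bessel_J' \<mu> x + bessel_J \<mu> x / x - bessel_J' (\<mu> + 1) x) (at x)"
proof -
  have y: "((\<lambda>x. (x / 2)\<^sup>2) has_field_derivative x / 2) (at x)"
    by (auto intro!: derivative_eq_intros)
  have l: "((\<lambda>x. ln (x / 2)) has_field_derivative 1 / x) (at x)"
    using assms by (auto intro!: derivative_eq_intros)
  show ?thesis unfolding bessel_J'_def
    by (rule DERIV_cong[OF DERIV_mult[OF half_powr_has_derivative[OF assms]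
          DERIV_add[OF DERIV_mult[OF l DERIV_chain2[OF bessel_F_has_derivative y]]
            DERIV_chain2[OF bessel_F'_has_derivative y]]]])
      (use assms in \<open>simp add: bessel_J_eq powr_add algebra_simps\<close>)
qed

lemma bessel_J_recur:
  assumes "x > 0"
  shows "bessel_J (\<mu> - 1) x + bessel_J (\<mu> + 1) x = 2 * \<mu> / x * bessel_J \<mu> x"
  using assms unfolding bessel_J_eq[OF assms] bessel_F_recur
  by (simp add: powr_add powr_diff field_simps power2_eq_square)

lemma bessel_J'_recur:
  assumes "x > 0"
  shows "bessel_J' (\<mu> - 1) x + bessel_J' (\<mu> + 1) x
    = 2 * \<mu> / x * bessel_J' \<mu> x + 2 / x * bessel_J \<mu> x"
  using assms unfolding bessel_J'_def bessel_J_eq[OF assms] bessel_F_recur bessel_F'_recur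
  by (simp add: powr_add powr_diff field_simps power2_eq_square)

lemma bessel_J_neg_nat:
  assumes "x > 0"
  shows "bessel_J (- real n) x = (-1) ^ n * bessel_J (real n) x"
proof -
  have "(x / 2) powr (- real n) * ((x / 2)\<^sup>2) ^ n = (x / 2) powr real n"
  proof -
    have "((x / 2)\<^sup>2) ^ n = (x / 2) powr real n * (x / 2) powr real n"
      using assms by (simp only: powr_realpow half_gt_zero power2_eq_square power_mult_distrib)
    then show ?thesis using assms by (simp add: powr_minus del: power_divide)
  qed
  then show ?thesis
    by (simp add: bessel_J_eq[OF assms] bessel_F_neg_nat power_minus[of "(x / 2)\<^sup>2"] mult_ac)
qed

text \<open>L'Hospital in the order: numerator and sine both vanish at \<open>n\<close>, so the
  limit of their quotient is the quotient of their derivatives.\<close>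

lemma bessel_Y_nat:
  assumes "x > 0"
  shows "bessel_Y (real n) x = (bessel_J' (real n) x + (-1) ^ n * bessel_J' (- real n) x) / pi"
proof -
  define N where "N = (\<lambda>\<xi>. bessel_J \<xi> x * cos (\<xi> * pi) - bessel_J (- \<xi>) x)"
  define S where "S = (\<lambda>\<xi>. sin (\<xi> * pi))"
  define N' where "N' = (-1) ^ n * bessel_J' (real n) x + bessel_J' (- real n) x"
  have c: "cos (real n * pi) = (-1) ^ n" by (simp add: cos_npi)
  have s: "sin (real n * pi) = 0" by simp
  have J: "((\<lambda>\<xi>. bessel_J (- \<xi>) x) has_field_derivative - bessel_J' (- real n) x) (at (real n))"
    using bessel_J_has_derivative_order[OF assms, of "- real n"] by (simp add: DERIV_mirror)
  have "(N has_field_derivative N') (at (real n))"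
    unfolding N_def N'_def
    by (auto intro!: derivative_eq_intros J bessel_J_has_derivative_order assms simp: c s)
  then have tN: "((\<lambda>\<xi>. (N \<xi> - N (real n)) / (\<xi> - real n)) \<longlongrightarrow> N') (at (real n))"
    by (simp add: has_field_derivative_iff)
  have "(S has_field_derivative (-1) ^ n * pi) (at (real n))"
    unfolding S_def by (auto intro!: derivative_eq_intros simp: c)
  then have tS: "((\<lambda>\<xi>. (S \<xi> - S (real n)) / (\<xi> - real n)) \<longlongrightarrow> (-1) ^ n * pi) (at (real n))"
    by (simp add: has_field_derivative_iff)
  \<comment> \<open>The numerator vanishes because the functions of orders \<open>n\<close> and
    \<open>- n\<close> differ by the factor \<open>(-1) ^ n\<close>, which is also the
    cosine.\<close>
  have z: "N (real n) = 0" "S (real n) = 0"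
    unfolding N_def S_def c bessel_J_neg_nat[OF assms] by (simp_all add: s)
  have "((\<lambda>\<xi>. ((N \<xi> - N (real n)) / (\<xi> - real n)) / ((S \<xi> - S (real n)) / (\<xi> - real n)))
      \<longlongrightarrow> N' / ((-1) ^ n * pi)) (at (real n))"
    by (rule tendsto_divide[OF tN tS]) simp
  then have "((\<lambda>\<xi>. bessel_Y_quot \<xi> x) \<longlongrightarrow> N' / ((-1) ^ n * pi)) (at (real n))"
    by (rule Lim_transform_eventually)
      (simp only: z, auto simp: bessel_Y_quot_def N_def S_def eventually_at_filter)
  then have "Lim (at (real n)) (\<lambda>\<xi>. bessel_Y_quot \<xi> x) = N' / ((-1) ^ n * pi)"
    by (intro tendsto_Lim) auto
  moreover have "N' / ((-1) ^ n * pi) = (bessel_J' (real n) x + (-1) ^ n * bessel_J' (- real n) x) / pi"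
    unfolding N'_def by (cases "even n") (auto simp: field_simps)
  ultimately show ?thesis by (simp add: bessel_Y_def)
qed

lemma bessel_Y_nonint:
  assumes "\<mu> \<notin> \<int>"
  shows "bessel_Y \<mu> x = (bessel_J \<mu> x * cos (\<mu> * pi) - bessel_J (- \<mu>) x) / sin (\<mu> * pi)"
  using assms by (simp add: bessel_Y_def bessel_Y_quot_def)

text \<open>\<open>bessel_Y\<close> has separate formulas for natural and for non-integer orders;
  for nonnegative orders these two cases are exhaustive.\<close>

lemma nonneg_real_cases:
  assumes "\<mu> \<ge> (0::real)"
  obtains (nat) n where "\<mu> = real n" | (nonint) "\<mu> \<notin> \<int>"
  using assms by (metis Ints_cases of_int_0_le_iff of_nat_nat of_int_of_nat_eq)

text \<open>For natural orders the inhomogeneous \<open>bessel_J\<close> terms of the two instances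
  of \<open>bessel_J'_recur\<close> cancel. For other orders the sign change of sine and cosine
  under a unit shift offsets the reversed sign in the recurrence at negative order.\<close>

lemma bessel_Y_recur:
  assumes "\<mu> \<ge> 0" "x > 0"
  shows "bessel_Y \<mu> x + bessel_Y (\<mu> + 2) x = 2 * (\<mu> + 1) / x * bessel_Y (\<mu> + 1) x"
  using assms(1)
proof (cases rule: nonneg_real_cases)
  case (nat n)
  have e: "bessel_Y \<mu> x = (bessel_J' (real n) x + (-1) ^ n * bessel_J' (- real n) x) / pi"
    "bessel_Y (\<mu> + 1) x = (bessel_J' (real n + 1) x - (-1) ^ n * bessel_J' (- real n - 1) x) / pi"
    "bessel_Y (\<mu> + 2) x = (bessel_J' (real n + 2) x + (-1) ^ n * bessel_J' (- real n - 2) x) / pi"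
    using bessel_Y_nat[OF assms(2), of n] bessel_Y_nat[OF assms(2), of "n + 1"]
      bessel_Y_nat[OF assms(2), of "n + 2"] nat by (simp_all add: add.commute minus_diff_commute)
  have r: "bessel_J' (real n) x = 2 * (real n + 1) / x * bessel_J' (real n + 1) x
      + 2 / x * bessel_J (real n + 1) x - bessel_J' (real n + 2) x"
    "bessel_J' (- real n) x = 2 * (- real n - 1) / x * bessel_J' (- real n - 1) x
      + 2 / x * bessel_J (- real n - 1) x - bessel_J' (- real n - 2) x"
    using bessel_J'_recur[OF assms(2), of "real n + 1"] bessel_J'_recur[OF assms(2), of "- real n - 1"]
    by (simp_all add: algebra_simps)
  have J: "bessel_J (- real n - 1) x = - ((-1) ^ n * bessel_J (real n + 1) x)"
    using bessel_J_neg_nat[OF assms(2), of "n + 1"] by (simp add: add.commute minus_diff_commute)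
  show ?thesis unfolding e r J using assms(2) nat
    by (cases "even n") (simp_all add: field_simps)
next
  case nonint
  have ni: "\<mu> + 1 \<notin> \<int>" "\<mu> + 2 \<notin> \<int>" using nonint by simp_all
  have r: "bessel_J \<mu> x = 2 * (\<mu> + 1) / x * bessel_J (\<mu> + 1) x - bessel_J (\<mu> + 2) x"
    "bessel_J (- \<mu>) x = 2 * (- \<mu> - 1) / x * bessel_J (- \<mu> - 1) x - bessel_J (- \<mu> - 2) x"
    using bessel_J_recur[OF assms(2), of "\<mu> + 1"] bessel_J_recur[OF assms(2), of "- \<mu> - 1"]
    by (simp_all add: algebra_simps)
  have s: "sin (\<mu> * pi) \<noteq> 0" using nonint by (auto simp: sin_zero_iff_int2)
  have m: "- (\<mu> + 1) = - \<mu> - 1" "- (\<mu> + 2) = - \<mu> - 2" by simp_all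
  have t: "sin ((\<mu> + 1) * pi) = - sin (\<mu> * pi)" "cos ((\<mu> + 1) * pi) = - cos (\<mu> * pi)"
    "sin ((\<mu> + 2) * pi) = sin (\<mu> * pi)" "cos ((\<mu> + 2) * pi) = cos (\<mu> * pi)"
    by (simp_all add: distrib_right sin_add cos_add)
  show ?thesis unfolding bessel_Y_nonint[OF nonint] bessel_Y_nonint[OF ni(1)] bessel_Y_nonint[OF ni(2)] t m r
    using s assms(2) by (simp add: field_simps)
qed

lemma bessel_Y_has_derivative:
  assumes "\<mu> \<ge> 0" "x > 0"
  shows "(bessel_Y \<mu> has_field_derivative \<mu> / x * bessel_Y \<mu> x - bessel_Y (\<mu> + 1) x) (at x)"
  using assms(1)
proof (cases rule: nonneg_real_cases)
  case (nat n)
  have Y1: "bessel_Y (real n + 1) x = (bessel_J' (real n + 1) x - (-1) ^ n * bessel_J' (- real n - 1) x) / pi"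
    using bessel_Y_nat[OF assms(2), of "n + 1"] nat by (simp add: add.commute minus_diff_commute)
  have r: "bessel_J' (- real n + 1) x = 2 * (- real n) / x * bessel_J' (- real n) x
      + 2 / x * bessel_J (- real n) x - bessel_J' (- real n - 1) x"
    using bessel_J'_recur[OF assms(2), of "- real n"] by (simp add: algebra_simps)
  show ?thesis
  proof (rule has_field_derivative_transform_within_open[where S = "{0<..}"])
    show "((\<lambda>x. (bessel_J' (real n) x + (-1) ^ n * bessel_J' (- real n) x) / pi) has_field_derivative
        \<mu> / x * bessel_Y \<mu> x - bessel_Y (\<mu> + 1) x) (at x)"
      by (rule DERIV_cong[OF DERIV_cdivide[OF DERIV_add[OF bessel_J'_has_derivative[OF assms(2)]
              DERIV_cmult[OF bessel_J'_has_derivative[OF assms(2)]]]]])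
        (unfold nat Y1 bessel_Y_nat[OF assms(2)] r bessel_J_neg_nat[OF assms(2)],
          use assms(2) in \<open>cases "even n"; simp add: field_simps\<close>)
  qed (use assms bessel_Y_nat nat in auto)
next
  case nonint
  have ni: "\<mu> + 1 \<notin> \<int>" using nonint by simp
  have s: "sin (\<mu> * pi) \<noteq> 0" using nonint by (auto simp: sin_zero_iff_int2)
  have m: "- (\<mu> + 1) = - \<mu> - 1" "- (\<mu> + 2) = - \<mu> - 2" by simp_all
  have t: "sin ((\<mu> + 1) * pi) = - sin (\<mu> * pi)" "cos ((\<mu> + 1) * pi) = - cos (\<mu> * pi)"
    by (simp_all add: distrib_right sin_add cos_add)
  have r: "bessel_J (- \<mu> + 1) x = 2 * (- \<mu>) / x * bessel_J (- \<mu>) x - bessel_J (- \<mu> - 1) x"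
    using bessel_J_recur[OF assms(2), of "- \<mu>"] by (simp add: algebra_simps)
  have *: "bessel_Y \<mu> = (\<lambda>x. (bessel_J \<mu> x * cos (\<mu> * pi) - bessel_J (- \<mu>) x) / sin (\<mu> * pi))"
    using bessel_Y_nonint[OF nonint] by blast
  show ?thesis unfolding *
    by (rule DERIV_cong[OF DERIV_cdivide[OF DERIV_diff[OF
          DERIV_cmult_right[OF bessel_J_has_derivative[OF assms(2)]] bessel_J_has_derivative[OF assms(2)]]]])
      (unfold bessel_Y_nonint[OF ni] bessel_Y_nonint[OF nonint] t m r, use s assms(2) in \<open>simp add: field_simps\<close>)
qed

section \<open>Recurrence and derivatives of cylinder functions\<close>

lemma cylinder_recur:
  assumes "\<mu> \<ge> 0" "x > 0"
  shows "cylinder \<alpha> \<mu> x + cylinder \<alpha> (\<mu> + 2) x = 2 * (\<mu> + 1) / x * cylinder \<alpha> (\<mu> + 1) x"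
proof -
  have "bessel_J \<mu> x + bessel_J (\<mu> + 2) x = 2 * (\<mu> + 1) / x * bessel_J (\<mu> + 1) x"
    using bessel_J_recur[OF assms(2), of "\<mu> + 1"] by (simp add: add.assoc)
  then have J: "bessel_J \<mu> x = 2 * (\<mu> + 1) / x * bessel_J (\<mu> + 1) x - bessel_J (\<mu> + 2) x" by simp
  have Y: "bessel_Y \<mu> x = 2 * (\<mu> + 1) / x * bessel_Y (\<mu> + 1) x - bessel_Y (\<mu> + 2) x"
    using bessel_Y_recur[OF assms] by simp
  show ?thesis unfolding cylinder_def J Y by (simp add: algebra_simps)
qed

lemma cylinder_has_derivative:
  assumes "\<mu> \<ge> 0" "x > 0"
  shows "(cylinder \<alpha> \<mu> has_field_derivative \<mu> / x * cylinder \<alpha> \<mu> x - cylinder \<alpha> (\<mu> + 1) x) (at x)"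
proof -
  have *: "cylinder \<alpha> \<mu> = (\<lambda>x. cos \<alpha> * bessel_J \<mu> x - sin \<alpha> * bessel_Y \<mu> x)" by (auto simp: cylinder_def)
  show ?thesis unfolding *
    by (rule DERIV_cong[OF DERIV_diff[OF DERIV_cmult[OF bessel_J_has_derivative[OF assms(2)]]
          DERIV_cmult[OF bessel_Y_has_derivative[OF assms]]]])
      (simp add: cylinder_def algebra_simps)
qed

text \<open>Eliminating order \<open>\<mu> + 2\<close> by the recurrence expresses the derivative
  through the next lower order.\<close>

lemma cylinder_has_derivative':
  assumes "\<mu> \<ge> 0" "x > 0"
  shows "(cylinder \<alpha> (\<mu> + 1) has_field_derivative
    cylinder \<alpha> \<mu> x - (\<mu> + 1) / x * cylinder \<alpha> (\<mu> + 1) x) (at x)"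
proof -
  have r: "cylinder \<alpha> \<mu> x = 2 * (\<mu> + 1) / x * cylinder \<alpha> (\<mu> + 1) x - cylinder \<alpha> (\<mu> + 2) x"
    using cylinder_recur[OF assms, of \<alpha>] by simp
  have "(cylinder \<alpha> (\<mu> + 1) has_field_derivative
      (\<mu> + 1) / x * cylinder \<alpha> (\<mu> + 1) x - cylinder \<alpha> (\<mu> + 2) x) (at x)"
    using cylinder_has_derivative[of "\<mu> + 1" x \<alpha>] assms by (simp add: add.assoc)
  then show ?thesis by (rule DERIV_cong) (simp add: r algebra_simps)
qed

section \<open>Behaviour of the functions as the argument tends to 0 from the right\<close>

lemma bessel_F_0 [simp]: "bessel_F \<mu> 0 = rGamma (\<mu> + 1)"
  and bessel_F'_0 [simp]: "bessel_F' \<mu> 0 = deriv rGamma (\<mu> + 1)"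
  unfolding bessel_F_def bessel_F'_def by (simp_all only: powser_zero) simp_all

lemma bessel_F_tendsto_0:
  "((\<lambda>x. bessel_F \<mu> ((x / 2)\<^sup>2)) \<longlongrightarrow> rGamma (\<mu> + 1)) (at_right 0)"
  "((\<lambda>x. bessel_F' \<mu> ((x / 2)\<^sup>2)) \<longlongrightarrow> deriv rGamma (\<mu> + 1)) (at_right 0)"
proof -
  have t: "((\<lambda>x. (x / 2)\<^sup>2) \<longlongrightarrow> 0) (at_right (0::real))" by (auto intro!: tendsto_eq_intros)
  show "((\<lambda>x. bessel_F \<mu> ((x / 2)\<^sup>2)) \<longlongrightarrow> rGamma (\<mu> + 1)) (at_right 0)"
    using isCont_tendsto_compose[OF DERIV_isCont[OF bessel_F_has_derivative] t] by simp
  show "((\<lambda>x. bessel_F' \<mu> ((x / 2)\<^sup>2)) \<longlongrightarrow> deriv rGamma (\<mu> + 1)) (at_right 0)"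
    using isCont_tendsto_compose[OF DERIV_isCont[OF bessel_F'_has_derivative] t] by simp
qed

lemma half_powr_tendsto_0:
  assumes "a > 0"
  shows "((\<lambda>x::real. (x / 2) powr a) \<longlongrightarrow> 0) (at_right 0)"
  using assms by real_asymp

lemma half_powr_times_bessel_J_tendsto_0:
  assumes "\<mu> > 0"
  shows "((\<lambda>x. (x / 2) powr \<mu> * bessel_J \<mu> x) \<longlongrightarrow> 0) (at_right 0)"
proof (rule Lim_transform_eventually)
  show "((\<lambda>x. (x / 2) powr (2 * \<mu>) * bessel_F \<mu> ((x / 2)\<^sup>2)) \<longlongrightarrow> 0) (at_right 0)"
    using tendsto_mult[OF half_powr_tendsto_0[of "2 * \<mu>"] bessel_F_tendsto_0(1)[of \<mu>]] assms by simp
  show "\<forall>\<^sub>F x in at_right 0. (x / 2) powr (2 * \<mu>) * bessel_F \<mu> ((x / 2)\<^sup>2) = (x / 2) powr \<mu> * bessel_J \<mu> x"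
    using eventually_at_right_less[of "0::real"]
    by eventually_elim (simp add: bessel_J_eq powr_add[symmetric])
qed

text \<open>After scaling, only the part of order \<open>- \<mu>\<close> survives at 0. Its constant
  comes from the slope of \<open>rGamma\<close> at a zero for integer orders, and from the
  reflection formula otherwise.\<close>

lemma half_powr_times_bessel_Y_tendsto:
  assumes "\<mu> > 0"
  shows "((\<lambda>x. (x / 2) powr \<mu> * bessel_Y \<mu> x) \<longlongrightarrow> - (Gamma \<mu> / pi)) (at_right 0)"
proof -
  have "\<mu> \<ge> 0" using assms by simp
  then show ?thesis
  proof (cases rule: nonneg_real_cases)
    case (nat n)
    then have n: "n > 0" using assms by simp
    \<comment> \<open>The scaled logarithmic terms of orders \<open>n\<close> and \<open>- n\<close>
      both carry this factor, the latter by \<open>bessel_F_neg_nat\<close>.\<close>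
    have ln: "((\<lambda>x. (x / 2) powr (2 * real n) * ln (x / 2)) \<longlongrightarrow> 0) (at_right 0)"
      using n by real_asymp
    have "(rGamma has_field_derivative (-1) ^ (n - 1) * fact (n - 1)) (at (- real (n - 1)))"
      by (rule has_field_derivative_rGamma_nonpos_int)
    then have d: "deriv rGamma (1 - real n) = (-1) ^ (n - 1) * fact (n - 1)"
      using n by (simp add: DERIV_imp_deriv of_nat_diff)
    have g: "Gamma \<mu> = fact (n - 1)" using Gamma_fact[of "n - 1", where 'a = real] n nat by (simp add: of_nat_diff)
    have sg: "(-1) ^ n * (-1) ^ (n - 1) = (-1 :: real)"
      using n by (cases n) (simp_all flip: power_mult_distrib)
    have "((\<lambda>x. ((x / 2) powr (2 * real n) * ln (x / 2) * (2 * bessel_F (real n) ((x / 2)\<^sup>2))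
         + (x / 2) powr (2 * real n) * bessel_F' (real n) ((x / 2)\<^sup>2)
         + (-1) ^ n * bessel_F' (- real n) ((x / 2)\<^sup>2)) / pi) \<longlongrightarrow>
         (0 * (2 * rGamma (real n + 1)) + 0 * deriv rGamma (real n + 1)
         + (-1) ^ n * deriv rGamma (- real n + 1)) / pi) (at_right 0)"
      by (intro tendsto_intros ln half_powr_tendsto_0 bessel_F_tendsto_0) (use n in auto)
    moreover have "(0 * (2 * rGamma (real n + 1)) + 0 * deriv rGamma (real n + 1)
         + (-1) ^ n * deriv rGamma (- real n + 1)) / pi = - (Gamma \<mu> / pi)"
      using sg by (simp add: d g flip: mult.assoc del: One_nat_def)
    moreover have "\<forall>\<^sub>F x in at_right 0.
        ((x / 2) powr (2 * real n) * ln (x / 2) * (2 * bessel_F (real n) ((x / 2)\<^sup>2))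
         + (x / 2) powr (2 * real n) * bessel_F' (real n) ((x / 2)\<^sup>2)
         + (-1) ^ n * bessel_F' (- real n) ((x / 2)\<^sup>2)) / pi = (x / 2) powr \<mu> * bessel_Y \<mu> x"
      using eventually_at_right_less[of "0::real"]
    proof eventually_elim
      case (elim x)
      define p where "p = (x / 2) powr real n"
      have p: "p > 0" "(x / 2) powr (2 * real n) = p * p" "(x / 2) powr (- real n) = inverse p"
        using elim by (simp_all add: p_def powr_minus flip: powr_add)
      have p4: "((x / 2)\<^sup>2) ^ n = p * p"
        using elim by (simp only: p_def powr_realpow half_gt_zero power2_eq_square power_mult_distrib)
      have F: "bessel_F (- real n) ((x / 2)\<^sup>2) = (-1) ^ n * (p * p * bessel_F (real n) ((x / 2)\<^sup>2))"
        unfolding bessel_F_neg_nat power_minus[of "(x / 2)\<^sup>2"] p4 by simp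
      show ?case unfolding nat bessel_Y_nat[OF elim] bessel_J'_def F p p_def[symmetric]
        using p(1) by (cases "even n") (simp_all add: field_simps)
    qed
    ultimately show ?thesis using Lim_transform_eventually by fastforce
  next
    case nonint
    have s: "sin (\<mu> * pi) \<noteq> 0" using nonint by (auto simp: sin_zero_iff_int2)
    have c: "1 - complex_of_real \<mu> = complex_of_real (1 - \<mu>)"
      "complex_of_real pi * complex_of_real \<mu> = complex_of_real (pi * \<mu>)" by simp_all
    \<comment> \<open>The reflection formula is applied over the complex numbers and carried back to
      the reals.\<close>
    have "complex_of_real (rGamma \<mu> * rGamma (1 - \<mu>)) = complex_of_real (sin (pi * \<mu>) / pi)"
      using rGamma_reflection_complex[of "complex_of_real \<mu>"]
      by (simp only: c rGamma_complex_of_real sin_of_real of_real_mult[symmetric] of_real_divide[symmetric])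
    then have "rGamma \<mu> * rGamma (1 - \<mu>) = sin (pi * \<mu>) / pi" by (simp only: of_real_eq_iff)
    moreover have "rGamma \<mu> = inverse (Gamma \<mu>)" "Gamma \<mu> > 0"
      using assms by (simp_all add: rGamma_inverse_Gamma Gamma_real_pos)
    ultimately have g: "rGamma (- \<mu> + 1) / sin (\<mu> * pi) = Gamma \<mu> / pi"
      using s by (simp add: field_simps)
    have "((\<lambda>x. ((x / 2) powr \<mu> * bessel_J \<mu> x * cos (\<mu> * pi) - bessel_F (- \<mu>) ((x / 2)\<^sup>2)) / sin (\<mu> * pi))
        \<longlongrightarrow> (0 * cos (\<mu> * pi) - rGamma (- \<mu> + 1)) / sin (\<mu> * pi)) (at_right 0)"
      by (intro tendsto_intros half_powr_times_bessel_J_tendsto_0 bessel_F_tendsto_0) (use s assms in auto)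
    moreover have "(0 * cos (\<mu> * pi) - rGamma (- \<mu> + 1)) / sin (\<mu> * pi) = - (Gamma \<mu> / pi)"
      using g by simp
    moreover have "\<forall>\<^sub>F x in at_right 0.
        ((x / 2) powr \<mu> * bessel_J \<mu> x * cos (\<mu> * pi) - bessel_F (- \<mu>) ((x / 2)\<^sup>2)) / sin (\<mu> * pi)
        = (x / 2) powr \<mu> * bessel_Y \<mu> x"
      using eventually_at_right_less[of "0::real"]
    proof eventually_elim
      case (elim x)
      have "bessel_F (- \<mu>) ((x / 2)\<^sup>2) = (x / 2) powr \<mu> * bessel_J (- \<mu>) x"
        using elim by (simp add: bessel_J_eq powr_minus)
      then show ?case by (simp add: bessel_Y_nonint[OF nonint] right_diff_distrib mult.assoc)
    qed
    ultimately show ?thesis using Lim_transform_eventually by fastforce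
  qed
qed

text \<open>For \<open>\<alpha> = 0\<close> the leading coefficient of \<open>bessel_J\<close> is
  positive. Otherwise \<open>sin \<alpha> > 0\<close> and the term with \<open>bessel_Y\<close>,
  which is negative near 0, dominates.\<close>

lemma cylinder_eventually_pos:
  assumes "0 \<le> \<alpha>" "\<alpha> < pi" "\<mu> > 0"
  shows "eventually (\<lambda>x. cylinder \<alpha> \<mu> x > 0) (at_right 0)"
proof (cases "\<alpha> = 0")
  case True
  have "rGamma (\<mu> + 1) > 0" using assms by (simp add: rGamma_inverse_Gamma Gamma_real_pos)
  then have "eventually (\<lambda>x. bessel_F \<mu> ((x / 2)\<^sup>2) > 0) (at_right 0)"
    by (rule order_tendstoD(1)[OF bessel_F_tendsto_0(1)])
  then show ?thesis using eventually_at_right_less[of "0::real"]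
    by eventually_elim (simp add: True cylinder_def bessel_J_eq)
next
  case False
  then have "sin \<alpha> > 0" using assms by (intro sin_gt_zero) auto
  then have pos: "cos \<alpha> * 0 - sin \<alpha> * (- (Gamma \<mu> / pi)) > 0"
    using Gamma_real_pos[OF assms(3)] by simp
  have "((\<lambda>x. cos \<alpha> * ((x / 2) powr \<mu> * bessel_J \<mu> x) - sin \<alpha> * ((x / 2) powr \<mu> * bessel_Y \<mu> x))
      \<longlongrightarrow> cos \<alpha> * 0 - sin \<alpha> * (- (Gamma \<mu> / pi))) (at_right 0)"
    by (intro tendsto_intros half_powr_times_bessel_J_tendsto_0 half_powr_times_bessel_Y_tendsto assms)
  from order_tendstoD(1)[OF this pos] eventually_at_right_less[of "0::real"] show ?thesis
  proof eventually_elim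
    case (elim x)
    then have "(x / 2) powr \<mu> * cylinder \<alpha> \<mu> x > 0" by (simp add: cylinder_def algebra_simps)
    then show ?case by (simp add: zero_less_mult_iff)
  qed
qed

subsection \<open>Zeros of differentiable functions\<close>

lemma continuous_on_of_DERIV:
  fixes f :: "real \<Rightarrow> real"
  assumes "\<And>x. x \<in> S \<Longrightarrow> (f has_field_derivative f' x) (at x)"
  shows "continuous_on S f"
  using assms by (blast intro: continuous_at_imp_continuous_on DERIV_isCont)

text \<open>At a first zero to the right of \<open>a\<close> the positive derivative would make
  \<open>G\<close> negative just before it, and the intermediate value theorem would give a still
  earlier zero.\<close>

lemma positive_of_upcrossing_zeros:
  fixes G :: "real \<Rightarrow> real"
  assumes "a \<le> b" "G a > 0"
    and der: "\<And>x. a \<le> x \<Longrightarrow> x \<le> b \<Longrightarrow> (G has_field_derivative G' x) (at x)"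
    and up: "\<And>x. a \<le> x \<Longrightarrow> x \<le> b \<Longrightarrow> G x = 0 \<Longrightarrow> G' x > 0"
  shows "G b > 0"
proof (rule ccontr)
  assume "\<not> G b > 0"
  have cont: "continuous_on {a..b} G"
    by (rule continuous_on_of_DERIV[where f' = G']) (use der in simp)
  define Z where "Z = {x \<in> {a..b}. G x = 0}"
  have "\<exists>x\<ge>a. x \<le> b \<and> G x = 0"
    using \<open>\<not> G b > 0\<close> assms cont by (intro IVT2') auto
  then have "Z \<noteq> {}" by (auto simp: Z_def)
  moreover have "closed Z"
    unfolding Z_def by (rule continuous_closed_preimage_constant[OF cont]) simp
  moreover have bdd: "bdd_below Z" by (auto simp: Z_def bdd_below_def)
  ultimately have z: "Inf Z \<in> Z" by (intro closed_contains_Inf)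
  define z where "z = Inf Z"
  have z: "a \<le> z" "z \<le> b" "G z = 0" using z by (auto simp: Z_def z_def)
  then have "a < z" using assms(2) by (cases "a = z") auto
  obtain d where d: "d > 0" "\<And>h. 0 < h \<Longrightarrow> h < d \<Longrightarrow> G (z - h) < G z"
    using DERIV_pos_inc_left[OF der[OF z(1,2)] up[OF z]] by auto
  \<comment> \<open>Small enough for the local monotonicity, and small enough not to step to the
    left of \<open>a\<close>.\<close>
  define h where "h = min (d / 2) (z - a)"
  have h: "0 < h" "h < d" "a \<le> z - h" using d(1) \<open>a < z\<close> by (auto simp: h_def)
  have "\<exists>x\<ge>a. x \<le> z - h \<and> G x = 0"
    using d(2)[OF h(1,2)] z h assms(2) continuous_on_subset[OF cont]
    by (intro IVT2') auto
  then obtain x where x: "x \<in> Z" "x \<le> z - h" using z h(1) by (auto simp: Z_def)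
  then have "z \<le> x" unfolding z_def by (intro cInf_lower bdd)
  then show False using x(2) h(1) by simp
qed

text \<open>Positivity of \<open>f\<close> between its zeros gives \<open>f' a \<ge> 0\<close> and
  \<open>f' b \<le> 0\<close>, so the end conditions force \<open>G a < 0 < G b\<close> and a zero
  exists. It is unique because \<open>G\<close> crosses zero only upwards.\<close>

lemma ex1_upcrossing_zero:
  fixes f G :: "real \<Rightarrow> real"
  assumes "a < b" "f a = 0" "f b = 0"
    and pos: "\<And>x. a < x \<Longrightarrow> x < b \<Longrightarrow> f x > 0"
    and f: "\<And>x. a \<le> x \<Longrightarrow> x \<le> b \<Longrightarrow> (f has_field_derivative f' x) (at x)"
    and G: "\<And>x. a \<le> x \<Longrightarrow> x \<le> b \<Longrightarrow> (G has_field_derivative G' x) (at x)"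
    and ends: "f' a * G a < 0" "f' b * G b < 0"
    and up: "\<And>x. a < x \<Longrightarrow> x < b \<Longrightarrow> G x = 0 \<Longrightarrow> G' x * f x > 0"
  shows "\<exists>!x. a < x \<and> x < b \<and> G x = 0"
proof (rule ex_ex1I)
  have "f' a \<ge> 0"
  proof (rule ccontr)
    assume "\<not> f' a \<ge> 0"
    then obtain d where d: "d > 0" "\<And>h. 0 < h \<Longrightarrow> h < d \<Longrightarrow> f (a + h) < f a"
      using DERIV_neg_dec_right[OF f[of a]] assms(1) by force
    define h where "h = min (d / 2) ((b - a) / 2)"
    have "0 < h" "h < d" "a + h < b" using d(1) assms(1) by (auto simp: h_def min_def field_simps)
    then show False using d(2)[of h] pos[of "a + h"] assms(2) by auto
  qed
  then have Ga: "G a < 0" using ends(1) by (simp add: mult_less_0_iff)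
  have "f' b \<le> 0"
  proof (rule ccontr)
    assume "\<not> f' b \<le> 0"
    then obtain d where d: "d > 0" "\<And>h. 0 < h \<Longrightarrow> h < d \<Longrightarrow> f (b - h) < f b"
      using DERIV_pos_inc_left[OF f[of b]] assms(1) by force
    define h where "h = min (d / 2) ((b - a) / 2)"
    have "0 < h" "h < d" "a < b - h" using d(1) assms(1) by (auto simp: h_def min_def field_simps)
    then show False using d(2)[of h] pos[of "b - h"] assms(3) by auto
  qed
  then have Gb: "G b > 0" using ends(2) by (simp add: mult_less_0_iff)
  have "continuous_on {a..b} G"
    by (rule continuous_on_of_DERIV[where f' = G']) (use G in simp)
  then have "\<exists>x\<ge>a. x \<le> b \<and> G x = 0" using Ga Gb assms(1) by (intro IVT') auto
  then show "\<exists>x. a < x \<and> x < b \<and> G x = 0" using Ga Gb by (metis less_eq_real_def less_irrefl)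
  have up': "G' x > 0" if "a < x" "x < b" "G x = 0" for x
    using up[OF that] pos[OF that(1,2)] by (simp add: zero_less_mult_iff)
  have no: False if xy: "a < x" "x < y" "y < b" "G x = 0" "G y = 0" for x y
  proof -
    \<comment> \<open>\<open>G\<close> is positive just after the zero \<open>x\<close> and then
      stays positive, so \<open>y\<close> cannot be a zero.\<close>
    obtain d where d: "d > 0" "\<And>h. 0 < h \<Longrightarrow> h < d \<Longrightarrow> G x < G (x + h)"
      using DERIV_pos_inc_right[OF G[of x] up'[of x]] xy by auto
    define h where "h = min (d / 2) (y - x)"
    have h: "0 < h" "h < d" "x + h \<le> y" using d(1) xy by (auto simp: h_def)
    have "G y > 0"
      by (rule positive_of_upcrossing_zeros[where a = "x + h" and G' = G'])
        (use d(2)[OF h(1,2)] xy h in \<open>auto intro!: G up'\<close>)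
    then show False using xy by simp
  qed
  show "x = y" if "a < x \<and> x < b \<and> G x = 0" "a < y \<and> y < b \<and> G y = 0" for x y
    using no[of x y] no[of y x] that by (cases x y rule: linorder_cases) auto
qed

lemma nonzero_same_sign:
  fixes f :: "real \<Rightarrow> real"
  assumes "continuous_on {a<..<b} f" "\<And>x. a < x \<Longrightarrow> x < b \<Longrightarrow> f x \<noteq> 0"
  shows "(\<forall>x. a < x \<and> x < b \<longrightarrow> f x > 0) \<or> (\<forall>x. a < x \<and> x < b \<longrightarrow> f x < 0)"
proof (rule ccontr)
  assume "\<not> ?thesis"
  then obtain x y where xy: "x \<in> {a<..<b}" "y \<in> {a<..<b}" "f x \<le> 0" "0 \<le> f y"
    by (auto simp: not_less)
  have "connected (f ` {a<..<b})" by (rule connected_continuous_image[OF assms(1)]) simp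
  then have "0 \<in> f ` {a<..<b}"
    by (rule connectedD_interval[OF _ imageI[OF xy(1)] imageI[OF xy(2)] xy(3,4)])
  then show False using assms(2) by auto
qed

text \<open>\<open>f\<close> has constant sign inside. Negating both \<open>f\<close> and
  \<open>G\<close> leaves the products in the hypotheses unchanged, so the negative case reduces to
  the positive one.\<close>

lemma ex1_zero_between:
  fixes f G :: "real \<Rightarrow> real"
  assumes "a < b" "f a = 0" "f b = 0"
    and nz: "\<And>x. a < x \<Longrightarrow> x < b \<Longrightarrow> f x \<noteq> 0"
    and f: "\<And>x. a \<le> x \<Longrightarrow> x \<le> b \<Longrightarrow> (f has_field_derivative f' x) (at x)"
    and G: "\<And>x. a \<le> x \<Longrightarrow> x \<le> b \<Longrightarrow> (G has_field_derivative G' x) (at x)"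
    and ends: "f' a * G a < 0" "f' b * G b < 0"
    and up: "\<And>x. a < x \<Longrightarrow> x < b \<Longrightarrow> G x = 0 \<Longrightarrow> G' x * f x > 0"
  shows "\<exists>!x. a < x \<and> x < b \<and> G x = 0"
proof -
  have "continuous_on {a<..<b} f"
    by (rule continuous_on_of_DERIV[where f' = f']) (use f in simp)
  from nonzero_same_sign[OF this nz] show ?thesis
  proof
    assume "\<forall>x. a < x \<and> x < b \<longrightarrow> f x > 0"
    then show ?thesis by (intro ex1_upcrossing_zero[of a b f f' G G']) (use assms in auto)
  next
    assume "\<forall>x. a < x \<and> x < b \<longrightarrow> f x < 0"
    then have "\<exists>!x. a < x \<and> x < b \<and> - G x = 0"
      by (intro ex1_upcrossing_zero[of a b "\<lambda>x. - f x" "\<lambda>x. - f' x" "\<lambda>x. - G x" "\<lambda>x. - G' x"])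
        (use assms in \<open>auto intro!: DERIV_minus\<close>)
    then show ?thesis by simp
  qed
qed

text \<open>Infinitely many zeros would accumulate at a zero \<open>x\<close>. Difference quotients
  between \<open>x\<close> and nearby zeros vanish, contrary to a nonzero derivative at
  \<open>x\<close>.\<close>

lemma finite_zeros_compact:
  fixes f :: "real \<Rightarrow> real"
  assumes f: "\<And>x. a \<le> x \<Longrightarrow> x \<le> b \<Longrightarrow> (f has_field_derivative f' x) (at x)"
    and nz: "\<And>x. a \<le> x \<Longrightarrow> x \<le> b \<Longrightarrow> f x = 0 \<Longrightarrow> f' x \<noteq> 0"
  shows "finite {x \<in> {a..b}. f x = 0}"
proof (rule ccontr)
  let ?Z = "{x \<in> {a..b}. f x = 0}"
  assume "infinite ?Z"
  then obtain x where x: "x \<in> {a..b}" "x islimpt ?Z"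
    using compact_eq_Bolzano_Weierstrass[of "{a..b}"] by auto
  have "continuous_on {a..b} f"
    by (rule continuous_on_of_DERIV[where f' = f']) (use f in simp)
  then have "closed ?Z" by (rule continuous_closed_preimage_constant) simp
  then have z: "f x = 0" using x(2) closed_limpt by blast
  have "((\<lambda>y. (f y - f x) / (y - x)) \<longlongrightarrow> f' x) (at x)"
    using f[of x] x(1) by (simp add: has_field_derivative_iff)
  then have "eventually (\<lambda>y. (f y - f x) / (y - x) \<noteq> 0) (at x)"
    by (rule tendsto_imp_eventually_ne) (use nz[of x] z x(1) in auto)
  then have "eventually (\<lambda>y. y \<notin> ?Z) (at x)"
    by eventually_elim (use z in auto)
  then show False using x(2) by (simp add: islimpt_iff_eventually)
qed

text \<open>Iterate the map sending \<open>b\<close> to the least element of \<open>S\<close> above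
  \<open>b\<close>, starting from the minimum. An element missed by this iteration would have
  infinitely many elements of \<open>S\<close> below it.\<close>

lemma incr_enum_exists:
  fixes S :: "real set"
  assumes fin: "\<And>b. finite {x \<in> S. x \<le> b}" and inf: "\<And>b. \<exists>x\<in>S. x > b"
  shows "\<exists>f :: nat \<Rightarrow> real. strict_mono f \<and> range f = S"
proof -
  have least: "\<exists>y. (y \<in> S \<and> b < y) \<and> (\<forall>z\<in>S. b < z \<longrightarrow> y \<le> z)" for b
  proof -
    obtain u where u: "u \<in> S" "u > b" using inf by blast
    define A where "A = {x \<in> S. x \<le> u \<and> b < x}"
    have A: "finite A" "u \<in> A"
      using u by (auto simp: A_def intro: rev_finite_subset[OF fin[of u]])
    then have "Min A \<in> A" by (intro Min_in) auto
    moreover have "Min A \<le> z" if "z \<in> S" "b < z" for z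
    proof (cases "z \<le> u")
      case True
      then show ?thesis using that A by (intro Min_le) (auto simp: A_def)
    next
      case False
      then show ?thesis using Min_le[OF A] by simp
    qed
    ultimately show ?thesis by (intro exI[of _ "Min A"]) (auto simp: A_def)
  qed
  then obtain s where s: "\<And>b. s b \<in> S \<and> b < s b" "\<And>b z. z \<in> S \<Longrightarrow> b < z \<Longrightarrow> s b \<le> z" by metis
  obtain u where u: "u \<in> S" using inf by blast
  define A where "A = {x \<in> S. x \<le> u}"
  have A: "finite A" "u \<in> A" using u fin by (auto simp: A_def)
  define l where "l = Min A"
  have l: "l \<in> S" "\<And>z. z \<in> S \<Longrightarrow> l \<le> z"
  proof -
    show "l \<in> S" using Min_in[OF A(1)] A(2) by (auto simp: l_def A_def)
    show "l \<le> z" if "z \<in> S" for z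
      using Min_le[OF A(1), of z] Min_le[OF A] that by (cases "z \<le> u") (auto simp: l_def A_def)
  qed
  define f where "f = rec_nat l (\<lambda>_. s)"
  have f: "f 0 = l" "\<And>n. f (Suc n) = s (f n)" by (simp_all add: f_def)
  have mono: "strict_mono f" by (auto simp: strict_mono_Suc_iff f s)
  have fS: "f n \<in> S" for n by (cases n) (simp_all add: f l s)
  moreover have "z \<in> range f" if z: "z \<in> S" for z
  proof (rule ccontr)
    assume nr: "z \<notin> range f"
    have "f n < z" for n
    proof (induction n)
      case 0
      then show ?case using l(2)[OF z] nr f by (metis order_le_less rangeI)
    next
      case (Suc n)
      then show ?case using s(2)[OF z Suc] nr f by (metis order_le_less rangeI)
    qed
    then have "range f \<subseteq> {x \<in> S. x \<le> z}" using fS by (auto intro: less_imp_le)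
    then have "finite (range f)" using fin finite_subset by blast
    then show False using strict_mono_imp_inj_on[OF mono] finite_imageD by blast
  qed
  ultimately show ?thesis using mono by blast
qed

subsection \<open>Zeros of cylinder functions\<close>

text \<open>The exponent \<open>2 * \<mu> + 2\<close> is chosen so that in the derivative the square
  of order \<open>\<mu> + 1\<close> cancels. The mixed products cancel as well, leaving a
  nonnegative multiple of the square of order \<open>\<mu>\<close>.\<close>

lemma cylinder_energy_mono:
  assumes "\<mu> \<ge> 0" "0 < x" "x \<le> y"
  shows "x powr (2 * \<mu> + 2) * ((cylinder \<alpha> \<mu> x)\<^sup>2 + (cylinder \<alpha> (\<mu> + 1) x)\<^sup>2)
    \<le> y powr (2 * \<mu> + 2) * ((cylinder \<alpha> \<mu> y)\<^sup>2 + (cylinder \<alpha> (\<mu> + 1) y)\<^sup>2)"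
proof (rule DERIV_nonneg_imp_nondecreasing[OF assms(3)])
  fix t assume "x \<le> t" "t \<le> y"
  then have t: "t > 0" using assms by simp
  let ?C = "cylinder \<alpha> \<mu>" and ?D = "cylinder \<alpha> (\<mu> + 1)"
  have 1: "((\<lambda>t. t powr (2 * \<mu> + 2)) has_field_derivative (2 * \<mu> + 2) / t * t powr (2 * \<mu> + 2)) (at t)"
  proof -
    have "t powr (2 * \<mu> + 2 - 1) = t powr (2 * \<mu> + 2) / t"
      using t by (simp only: powr_diff powr_one)
    then show ?thesis using has_real_derivative_powr[OF t, of "2 * \<mu> + 2"] by simp
  qed
  have "((\<lambda>t. t powr (2 * \<mu> + 2) * ((?C t)\<^sup>2 + (?D t)\<^sup>2)) has_field_derivative
     t powr (2 * \<mu> + 2) * ((4 * \<mu> + 2) / t * (?C t)\<^sup>2)) (at t)"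
    by (rule DERIV_cong[OF DERIV_mult[OF 1 DERIV_add[OF
          DERIV_power[OF cylinder_has_derivative[OF assms(1) t]]
          DERIV_power[OF cylinder_has_derivative'[OF assms(1) t]]]]])
      (use t in \<open>simp add: field_simps power2_eq_square\<close>)
  moreover have "t powr (2 * \<mu> + 2) * ((4 * \<mu> + 2) / t * (?C t)\<^sup>2) \<ge> 0"
    using t assms(1) by simp
  ultimately show "\<exists>d. ((\<lambda>t. t powr (2 * \<mu> + 2) * ((?C t)\<^sup>2 + (?D t)\<^sup>2)) has_real_derivative d) (at t) \<and> 0 \<le> d"
    by blast
qed

text \<open>A common zero makes the energy vanish at \<open>x\<close> and hence at all smaller
  positive points, contradicting positivity near 0. At a zero the derivative is minus the function
  of order \<open>\<mu> + 1\<close>, so zeros are simple.\<close>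

lemma cylinder_zero_simple:
  assumes "0 \<le> \<alpha>" "\<alpha> < pi" "\<mu> > 0" "x > 0" "cylinder \<alpha> \<mu> x = 0"
  shows "cylinder \<alpha> (\<mu> + 1) x \<noteq> 0"
proof
  assume z: "cylinder \<alpha> (\<mu> + 1) x = 0"
  have "eventually (\<lambda>t. cylinder \<alpha> \<mu> t > 0 \<and> 0 < t \<and> t < x) (at_right 0)"
    using cylinder_eventually_pos[OF assms(1-3)] eventually_at_right_less[of "0::real"]
      eventually_at_right_real[OF assms(4)] by eventually_elim auto
  then obtain t where t: "cylinder \<alpha> \<mu> t > 0" "0 < t" "t < x"
    using eventually_happens by fastforce
  have "t powr (2 * \<mu> + 2) * ((cylinder \<alpha> \<mu> t)\<^sup>2 + (cylinder \<alpha> (\<mu> + 1) t)\<^sup>2) \<le> 0"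
    using cylinder_energy_mono[of \<mu> t x \<alpha>] t assms z by simp
  moreover have "t powr (2 * \<mu> + 2) * ((cylinder \<alpha> \<mu> t)\<^sup>2 + (cylinder \<alpha> (\<mu> + 1) t)\<^sup>2) > 0"
    using t by (intro mult_pos_pos add_pos_nonneg) auto
  ultimately show False by simp
qed

text \<open>The quotient \<open>r = C\<^bsub>\<mu>+1\<^esub> / C\<^sub>\<mu>\<close> satisfies a Riccati equation, by which \<open>(arctan r)' \<ge> 1/2\<close> for
  \<open>x \<ge> 2\<mu> + 1\<close>; as \<open>arctan\<close> is bounded, \<open>r\<close> has a pole in every interval of length \<open>2\<pi>\<close>.\<close>

lemma cylinder_zero_exists:
  assumes "\<mu> \<ge> 0"
  shows "\<exists>x>b. cylinder \<alpha> \<mu> x = 0"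
proof (rule ccontr)
  assume no: "\<not> (\<exists>x>b. cylinder \<alpha> \<mu> x = 0)"
  \<comment> \<open>Beyond \<open>a\<close> there are no zeros by assumption, and the coefficient
    \<open>(2 * \<mu> + 1) / t\<close> is at most 1.\<close>
  define a where "a = max (b + 1) (2 * \<mu> + 1)"
  define r where "r = (\<lambda>x. cylinder \<alpha> (\<mu> + 1) x / cylinder \<alpha> \<mu> x)"
  define g where "g = (\<lambda>x. arctan (r x) - x / 2)"
  have "g a \<le> g (a + 2 * pi)"
  proof (rule DERIV_nonneg_imp_nondecreasing[where f = g])
    fix t assume "a \<le> t"
    then have t: "t \<ge> 2 * \<mu> + 1" "t > 0" "t > b" using assms by (auto simp: a_def)
    then have nz: "cylinder \<alpha> \<mu> t \<noteq> 0" using no by blast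
    have r: "(r has_field_derivative 1 - (2 * \<mu> + 1) / t * r t + (r t)\<^sup>2) (at t)"
      unfolding r_def
      by (rule DERIV_cong[OF DERIV_divide[OF cylinder_has_derivative'[OF assms t(2)]
              cylinder_has_derivative[OF assms t(2)] nz]])
        (use nz t in \<open>simp add: field_simps power2_eq_square\<close>)
    have p: "1 + (r t)\<^sup>2 > 0" by (simp add: add_pos_nonneg)
    have "(2 * \<mu> + 1) / t * r t \<le> \<bar>(2 * \<mu> + 1) / t\<bar> * \<bar>r t\<bar>"
      unfolding abs_mult[symmetric] by (rule abs_ge_self)
    also have "\<dots> \<le> 1 * \<bar>r t\<bar>" using t assms by (intro mult_right_mono) auto
    also have "\<dots> \<le> (1 + (r t)\<^sup>2) / 2"
      using sum_squares_bound[of "\<bar>r t\<bar>" 1] by simp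
    finally have "inverse (1 + (r t)\<^sup>2) * (1 - (2 * \<mu> + 1) / t * r t + (r t)\<^sup>2) - 1 / 2 \<ge> 0"
      using p by (simp add: field_simps)
    moreover have "(g has_field_derivative
        inverse (1 + (r t)\<^sup>2) * (1 - (2 * \<mu> + 1) / t * r t + (r t)\<^sup>2) - 1 / 2) (at t)"
      unfolding g_def
      by (intro DERIV_diff DERIV_chain2[OF DERIV_arctan r]) (auto intro!: derivative_eq_intros)
    ultimately show "\<exists>y. (g has_real_derivative y) (at t) \<and> 0 \<le> y" by blast
  qed simp
  \<comment> \<open>Over a length of \<open>2 * pi\<close> the arctangent would rise by at least
    \<open>pi\<close>, but its values lie strictly between \<open>- pi / 2\<close> and
    \<open>pi / 2\<close>.\<close>
  then show False
    using arctan_lbound[of "r a"] arctan_ubound[of "r (a + 2 * pi)"]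
    unfolding g_def add_divide_distrib by linarith
qed

text \<open>Positivity near 0 keeps the zeros away from 0, so those up to \<open>b\<close> lie in a
  compact interval and, being simple, are finite in number.\<close>

lemma cylinder_zeros_enum:
  assumes "0 \<le> \<alpha>" "\<alpha> < pi" "\<mu> > 0"
  shows "\<exists>f :: nat \<Rightarrow> real. strict_mono f \<and> range f = {x. x > 0 \<and> cylinder \<alpha> \<mu> x = 0}"
proof (rule incr_enum_exists)
  obtain d where d: "d > 0" "\<And>x. 0 < x \<Longrightarrow> x < d \<Longrightarrow> cylinder \<alpha> \<mu> x > 0"
    using cylinder_eventually_pos[OF assms] by (auto simp: eventually_at_right_field)
  show "finite {x \<in> {x. x > 0 \<and> cylinder \<alpha> \<mu> x = 0}. x \<le> b}" for b
  proof (rule finite_subset)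
    have \<mu>: "\<mu> \<ge> 0" using assms by simp
    have pos: "x > 0" if "d \<le> x" for x using that d(1) by simp
    show "finite {x \<in> {d..b}. cylinder \<alpha> \<mu> x = 0}"
      by (rule finite_zeros_compact, erule cylinder_has_derivative[OF \<mu> pos])
        (use cylinder_zero_simple[OF assms pos] in auto)
    show "{x \<in> {x. x > 0 \<and> cylinder \<alpha> \<mu> x = 0}. x \<le> b} \<subseteq> {x \<in> {d..b}. cylinder \<alpha> \<mu> x = 0}"
      using d(2) by (force simp: not_less[symmetric])
  qed
  show "\<exists>x\<in>{x. x > 0 \<and> cylinder \<alpha> \<mu> x = 0}. x > b" for b
    using cylinder_zero_exists[of \<mu> "max 0 b" \<alpha>] assms by auto
qed

subsection \<open>Lommel polynomials\<close>

definition lommel_coeff :: "real \<Rightarrow> nat \<Rightarrow> nat \<Rightarrow> real" where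
  "lommel_coeff \<mu> n k = (-1) ^ k * real ((n - k) choose k) * (Gamma (\<mu> + real n - real k) / Gamma (\<mu> + real k))"

lemma lommel_coeff_eq_0: "n < 2 * k \<Longrightarrow> lommel_coeff \<mu> n k = 0"
  by (simp add: lommel_coeff_def binomial_eq_0)

text \<open>Binomials beyond the range vanish, so sums for different \<open>n\<close> can share one
  upper limit.\<close>

lemma lommel_R_eq:
  assumes "n div 2 \<le> N"
  shows "lommel_R n \<mu> x = (\<Sum>k\<le>N. lommel_coeff \<mu> n k * (x / 2) powi (2 * int k - int n))"
proof -
  have "lommel_R n \<mu> x = (\<Sum>k = 0..n div 2. lommel_coeff \<mu> n k * (x / 2) powi (2 * int k - int n))"
    by (simp add: lommel_R_def lommel_coeff_def)
  also have "\<dots> = (\<Sum>k\<le>N. lommel_coeff \<mu> n k * (x / 2) powi (2 * int k - int n))"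
    by (rule sum.mono_neutral_left) (use assms in \<open>auto simp: lommel_coeff_eq_0\<close>)
  finally show ?thesis .
qed

lemma lommel_coeff_0_recur:
  assumes "\<mu> > 0"
  shows "lommel_coeff \<mu> (Suc n) 0 = (\<mu> + real n) * lommel_coeff \<mu> n 0"
  using Gamma_plus1[of "\<mu> + real n"] assms
  by (simp add: lommel_coeff_def add_ac pos_add_strict nonpos_Ints_def)

text \<open>Pascal's rule splits the left binomial. With all Gamma quotients expressed through one
  factor \<open>g\<close>, the rest is the absorption identity
  \<open>(j + 1) * (p choose (j + 1)) = (p - j) * (p choose j)\<close>.\<close>

lemma lommel_coeff_Suc_recur:
  assumes "\<mu> > 0" "2 * Suc j \<le> Suc n"
  shows "lommel_coeff \<mu> (Suc n) (Suc j)
    = (\<mu> + real n) * lommel_coeff \<mu> n (Suc j) - lommel_coeff \<mu> (n - 1) j"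
proof -
  define p where "p = n - Suc j"
  have p: "j \<le> p" "n = p + Suc j" using assms(2) by (auto simp: p_def)
  have nn: "z \<notin> \<int>\<^sub>\<le>\<^sub>0" if "z > 0" for z :: real using that by (auto elim!: nonpos_Ints_cases)
  have "Suc j * (p choose Suc j) = (p - j) * (p choose j)"
    by (simp only: binomial_absorption binomial_absorb_comp)
  then have "real (Suc j * (p choose Suc j)) = real ((p - j) * (p choose j))" by (rule arg_cong)
  then have b: "(real j + 1) * real (p choose Suc j) = (real p - real j) * real (p choose j)"
    using p(1) by (simp add: of_nat_diff distrib_right)
  define g where "g = Gamma (\<mu> + real p) / Gamma (\<mu> + real j + 1)"
  have "Gamma (\<mu> + real p + 1) = (\<mu> + real p) * Gamma (\<mu> + real p)"
    "Gamma (\<mu> + real j + 1) = (\<mu> + real j) * Gamma (\<mu> + real j)"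
    using assms(1) by (auto intro!: Gamma_plus1 nn)
  moreover have "\<mu> + real j > 0" using assms(1) by simp
  ultimately have g: "Gamma (\<mu> + real p + 1) / Gamma (\<mu> + real j + 1) = (\<mu> + real p) * g"
    "Gamma (\<mu> + real p) / Gamma (\<mu> + real j) = (\<mu> + real j) * g"
    by (simp_all add: g_def)
  have 1: "lommel_coeff \<mu> (Suc n) (Suc j)
      = - ((-1) ^ j * (real (p choose Suc j) + real (p choose j)) * ((\<mu> + real p) * g))"
    unfolding g(1)[symmetric] by (simp add: lommel_coeff_def p(2) add_ac)
  have 2: "lommel_coeff \<mu> n (Suc j) = - ((-1) ^ j * real (p choose Suc j) * g)"
    unfolding g_def by (simp add: lommel_coeff_def p(2) add_ac)
  have 3: "lommel_coeff \<mu> (n - 1) j = (-1) ^ j * real (p choose j) * ((\<mu> + real j) * g)"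
    unfolding g(2)[symmetric] by (simp add: lommel_coeff_def p(2) add_ac)
  have "(real (p choose Suc j) + real (p choose j)) * (\<mu> + real p)
      = (\<mu> + real n) * real (p choose Suc j) + (\<mu> + real j) * real (p choose j)"
    using b p(2) by (simp add: algebra_simps)
  then have "- ((-1) ^ j * g * ((real (p choose Suc j) + real (p choose j)) * (\<mu> + real p)))
      = - ((-1) ^ j * g * ((\<mu> + real n) * real (p choose Suc j) + (\<mu> + real j) * real (p choose j)))"
    by (rule arg_cong)
  then show ?thesis unfolding 1 2 3 by (simp add: algebra_simps)
qed

lemma lommel_R_recur:
  assumes "\<mu> > 0" "x > 0" "n > 0"
  shows "lommel_R (Suc n) \<mu> x = 2 * (\<mu> + real n) / x * lommel_R n \<mu> x - lommel_R (n - 1) \<mu> x"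
proof -
  define t where "t = x / 2"
  have t: "t > 0" using assms by (simp add: t_def)
  define N where "N = Suc n div 2"
  have N: "0 < N" "n div 2 \<le> N" "(n - 1) div 2 \<le> N - 1" "Suc n div 2 \<le> N"
    using assms(3) by (auto simp: N_def)
  let ?e = "\<lambda>k. 2 * int k - int (Suc n)"
  have 1: "(\<mu> + real n) / t * lommel_R n \<mu> x = (\<Sum>k\<le>N. (\<mu> + real n) * lommel_coeff \<mu> n k * t powi ?e k)"
  proof -
    have "t powi ?e k = t powi (2 * int k - int n) / t" for k
      using power_int_diff[of t "2 * int k - int n" 1] t by (simp add: diff_diff_eq add.commute)
    then show ?thesis unfolding lommel_R_eq[OF N(2)] t_def[symmetric] sum_distrib_left
      by (intro sum.cong) auto
  qed
  \<comment> \<open>Lowering the degree by two relative to \<open>Suc n\<close> shifts the summation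
    index by one, which matches \<open>lommel_coeff_Suc_recur\<close>.\<close>
  have 2: "lommel_R (n - 1) \<mu> x = (\<Sum>j\<le>N - 1. lommel_coeff \<mu> (n - 1) j * t powi ?e (Suc j))"
  proof -
    have "2 * int j - int (n - 1) = ?e (Suc j)" for j using assms(3) by simp
    then show ?thesis unfolding lommel_R_eq[OF N(3)] t_def[symmetric] by (simp only:)
  qed
  have split: "(\<Sum>k\<le>N. h k) = h 0 + (\<Sum>j\<le>N - 1. h (Suc j))" for h :: "nat \<Rightarrow> real"
    using sum.atMost_Suc_shift[of h "N - 1"] N(1) by simp
  have "(\<Sum>j\<le>N - 1. lommel_coeff \<mu> (Suc n) (Suc j) * t powi ?e (Suc j))
      = (\<Sum>j\<le>N - 1. (\<mu> + real n) * lommel_coeff \<mu> n (Suc j) * t powi ?e (Suc j)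
          - lommel_coeff \<mu> (n - 1) j * t powi ?e (Suc j))"
  proof (rule sum.cong[OF refl])
    fix j assume "j \<in> {..N - 1}"
    then have "2 * Suc j \<le> Suc n" using N(1) by (auto simp: N_def)
    from lommel_coeff_Suc_recur[OF assms(1) this]
    show "lommel_coeff \<mu> (Suc n) (Suc j) * t powi ?e (Suc j)
      = (\<mu> + real n) * lommel_coeff \<mu> n (Suc j) * t powi ?e (Suc j)
          - lommel_coeff \<mu> (n - 1) j * t powi ?e (Suc j)"
      by (simp only: left_diff_distrib)
  qed
  then have "lommel_R (Suc n) \<mu> x = (\<mu> + real n) / t * lommel_R n \<mu> x - lommel_R (n - 1) \<mu> x"
    unfolding lommel_R_eq[OF N(4)] t_def[symmetric] 1 2 split lommel_coeff_0_recur[OF assms(1)]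
    by (simp only: sum_subtractf)
  then show ?thesis using t by (simp add: t_def)
qed

text \<open>The index is shifted so that the sequence starts with 0, 1 and obeys in \<open>j\<close>
  the recurrence of the cylinder functions of order \<open>\<nu> + j\<close>.\<close>

fun lommel_Q :: "real \<Rightarrow> nat \<Rightarrow> real \<Rightarrow> real" where
  "lommel_Q \<nu> 0 x = 0"
| "lommel_Q \<nu> (Suc 0) x = 1"
| "lommel_Q \<nu> (Suc (Suc j)) x = 2 * (\<nu> + real (Suc j)) / x * lommel_Q \<nu> (Suc j) x - lommel_Q \<nu> j x"

text \<open>Here the prime is the derivative in \<open>x\<close>, obtained by differentiating the
  recursion.\<close>

fun lommel_Q' :: "real \<Rightarrow> nat \<Rightarrow> real \<Rightarrow> real" where
  "lommel_Q' \<nu> 0 x = 0"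
| "lommel_Q' \<nu> (Suc 0) x = 0"
| "lommel_Q' \<nu> (Suc (Suc j)) x = 2 * (\<nu> + real (Suc j)) / x * lommel_Q' \<nu> (Suc j) x
    - 2 * (\<nu> + real (Suc j)) / x\<^sup>2 * lommel_Q \<nu> (Suc j) x - lommel_Q' \<nu> j x"

lemma lommel_R_eq_Q:
  assumes "\<nu> > 0" "x > 0"
  shows "lommel_R n (\<nu> + 1) x = lommel_Q \<nu> (Suc n) x"
proof (induction n rule: less_induct)
  case (less n)
  have nn: "\<nu> + 1 \<notin> \<int>\<^sub>\<le>\<^sub>0" using assms by (auto elim!: nonpos_Ints_cases)
  then have g: "Gamma (\<nu> + 1) \<noteq> 0" by (simp add: Gamma_eq_zero_iff)
  consider "n = 0" | "n = 1" | j where "n = Suc (Suc j)"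
    by (metis One_nat_def not0_implies_Suc)
  then show ?case
  proof cases
    case 1
    then show ?thesis using g by (simp add: lommel_R_def)
  next
    case 2
    have "Gamma (\<nu> + 2) = (\<nu> + 1) * Gamma (\<nu> + 1)"
      using Gamma_plus1[OF nn] by (simp add: add.assoc)
    then show ?thesis using 2 g by (simp add: lommel_R_def power_int_minus add.assoc)
  next
    case (3 j)
    then show ?thesis
      using lommel_R_recur[of "\<nu> + 1" x "Suc j"] assms less.IH[of "Suc j"] less.IH[of j]
      by (simp add: add_ac)
  qed
qed

lemma lommel_Q_has_derivative:
  assumes "x \<noteq> 0"
  shows "(lommel_Q \<nu> n has_field_derivative lommel_Q' \<nu> n x) (at x)"
proof (induction n rule: less_induct)
  case (less n)
  consider "n = 0" | "n = 1" | j where "n = Suc (Suc j)"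
    by (metis One_nat_def not0_implies_Suc)
  then show ?case
  proof cases
    case 1
    have "lommel_Q \<nu> 0 = (\<lambda>x. 0)" by auto
    then show ?thesis using 1 by simp
  next
    case 2
    have "lommel_Q \<nu> (Suc 0) = (\<lambda>x. 1)" by auto
    then show ?thesis using 2 by simp
  next
    case (3 j)
    have a: "((\<lambda>x. 2 * (\<nu> + real (Suc j)) / x) has_field_derivative - (2 * (\<nu> + real (Suc j)) / x\<^sup>2)) (at x)"
      using DERIV_cmult[OF DERIV_inverse[OF assms], of "2 * (\<nu> + real (Suc j))"]
      by (simp add: divide_inverse power_inverse power2_eq_square del: of_nat_Suc)
    have e: "lommel_Q \<nu> (Suc (Suc j)) = (\<lambda>x. 2 * (\<nu> + real (Suc j)) / x * lommel_Q \<nu> (Suc j) x - lommel_Q \<nu> j x)"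
      by auto
    show ?thesis unfolding 3 e
      by (rule DERIV_cong[OF DERIV_diff[OF DERIV_mult[OF a less.IH[of "Suc j"]] less.IH[of j]]])
        (simp_all add: 3 algebra_simps)
  qed
qed

text \<open>By the recurrence each step only subtracts a nonnegative multiple of a square, and the
  initial value is \<open>- 2 * (\<nu> + 1) / x\<^sup>2\<close>.\<close>

lemma lommel_Q_wronskian_neg:
  assumes "\<nu> \<ge> 0" "x > 0"
  shows "lommel_Q' \<nu> (Suc (Suc n)) x * lommel_Q \<nu> (Suc n) x
    - lommel_Q \<nu> (Suc (Suc n)) x * lommel_Q' \<nu> (Suc n) x < 0"
proof (induction n)
  case 0
  then show ?case using assms by simp
next
  case (Suc n)
  have "lommel_Q' \<nu> (Suc (Suc (Suc n))) x * lommel_Q \<nu> (Suc (Suc n)) x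
    - lommel_Q \<nu> (Suc (Suc (Suc n))) x * lommel_Q' \<nu> (Suc (Suc n)) x
    = lommel_Q' \<nu> (Suc (Suc n)) x * lommel_Q \<nu> (Suc n) x
    - lommel_Q \<nu> (Suc (Suc n)) x * lommel_Q' \<nu> (Suc n) x
    - 2 * (\<nu> + real (Suc (Suc n))) / x\<^sup>2 * (lommel_Q \<nu> (Suc (Suc n)) x)\<^sup>2"
    by (simp only: lommel_Q.simps(3)[of \<nu> "Suc n"] lommel_Q'.simps(3)[of \<nu> "Suc n"])
      (simp only: algebra_simps power2_eq_square)
  moreover have "2 * (\<nu> + real (Suc (Suc n))) / x\<^sup>2 * (lommel_Q \<nu> (Suc (Suc n)) x)\<^sup>2 \<ge> 0"
    using assms by (intro mult_nonneg_nonneg divide_nonneg_nonneg) auto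
  ultimately show ?case using Suc by linarith
qed

text \<open>For \<open>x \<le> \<nu>\<close> the coefficient in the recurrence is at least 2, so
  successive differences never drop below the initial one, which is 1.\<close>

lemma lommel_Q_pos:
  assumes "0 < x" "x \<le> \<nu>"
  shows "lommel_Q \<nu> (Suc n) x > 0"
proof -
  have "lommel_Q \<nu> n x \<ge> 0 \<and> lommel_Q \<nu> (Suc n) x \<ge> lommel_Q \<nu> n x + 1"
  proof (induction n)
    case (Suc n)
    have "2 \<le> 2 * (\<nu> + real (Suc n)) / x" using assms by (simp add: field_simps)
    then have "2 * lommel_Q \<nu> (Suc n) x \<le> 2 * (\<nu> + real (Suc n)) / x * lommel_Q \<nu> (Suc n) x"
      using Suc by (intro mult_right_mono) auto
    then show ?case using Suc unfolding lommel_Q.simps(3) by linarith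
  qed simp
  then show ?thesis by linarith
qed

section \<open>Cylinder functions and Lommel polynomials linked by their common recurrence\<close>

lemma cylinder_Suc_recur:
  assumes "\<nu> \<ge> 0" "x > 0"
  shows "cylinder \<alpha> (\<nu> + real (Suc (Suc j))) x
    = 2 * (\<nu> + real (Suc j)) / x * cylinder \<alpha> (\<nu> + real (Suc j)) x - cylinder \<alpha> (\<nu> + real j) x"
  using cylinder_recur[of "\<nu> + real j" x \<alpha>] assms by (simp add: add_ac)

lemma cylinder_lommel_casoratian:
  assumes "\<nu> \<ge> 0" "x > 0"
  shows "cylinder \<alpha> (\<nu> + real j) x * lommel_Q \<nu> (Suc j) x
    - cylinder \<alpha> (\<nu> + real (Suc j)) x * lommel_Q \<nu> j x = cylinder \<alpha> \<nu> x"
proof (induction j)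
  case (Suc j)
  then show ?case
    unfolding cylinder_Suc_recur[OF assms] lommel_Q.simps(3) by (simp only: algebra_simps)
qed simp

text \<open>At a zero of the function of order \<open>\<nu>\<close> both sides solve the same
  recurrence in \<open>j\<close> with equal values at \<open>j = 0\<close> and
  \<open>j = 1\<close>.\<close>

lemma cylinder_eq_lommel_at_zero:
  assumes "\<nu> \<ge> 0" "x > 0" "cylinder \<alpha> \<nu> x = 0"
  shows "cylinder \<alpha> (\<nu> + real j) x = cylinder \<alpha> (\<nu> + 1) x * lommel_Q \<nu> j x"
proof (induction j rule: less_induct)
  case (less j)
  consider "j = 0" | "j = 1" | i where "j = Suc (Suc i)"
    by (metis One_nat_def not0_implies_Suc)
  then show ?case
  proof cases
    case (3 i)
    then show ?thesis
      using less.IH[of "Suc i"] less.IH[of i]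
      by (simp only: 3 cylinder_Suc_recur[OF assms(1,2)] lommel_Q.simps(3)) (simp add: right_diff_distrib)
  qed (use assms in simp_all)
qed

lemma cylinder_lommel_product_derivative_sign:
  assumes "\<nu> \<ge> 0" "x > 0" "cylinder \<alpha> \<nu> x \<noteq> 0"
    and z: "cylinder \<alpha> (\<nu> + real (Suc n)) x * lommel_Q \<nu> (Suc n) x = 0"
  shows "((cylinder \<alpha> (\<nu> + real n) x
      - (\<nu> + real (Suc n)) / x * cylinder \<alpha> (\<nu> + real (Suc n)) x) * lommel_Q \<nu> (Suc n) x
      + cylinder \<alpha> (\<nu> + real (Suc n)) x * lommel_Q' \<nu> (Suc n) x) * cylinder \<alpha> \<nu> x > 0"
proof -
  note cas = cylinder_lommel_casoratian[OF assms(1,2), of \<alpha> n]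
  have sq: "cylinder \<alpha> \<nu> x * cylinder \<alpha> \<nu> x > 0" using assms(3) by (metis not_real_square_gt_zero)
  show ?thesis
  proof (cases "cylinder \<alpha> (\<nu> + real (Suc n)) x = 0")
    \<comment> \<open>Only the first product remains, and the Casoratian turns the whole expression
      into the square of \<open>cylinder \<alpha> \<nu> x\<close>.\<close>
    case True
    then have "cylinder \<alpha> (\<nu> + real n) x * lommel_Q \<nu> (Suc n) x = cylinder \<alpha> \<nu> x"
      using cas by simp
    then show ?thesis using sq unfolding True by simp
  next
    case False
    then have Q: "lommel_Q \<nu> (Suc n) x = 0" using z by simp
    \<comment> \<open>\<open>n = 0\<close> is excluded since \<open>lommel_Q \<nu> 1\<close> is
      constantly 1; the Wronskian bound then applies.\<close>
    then obtain i where n: "n = Suc i" by (cases n) auto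
    define p where "p = cylinder \<alpha> (\<nu> + real (Suc n)) x"
    have c: "cylinder \<alpha> \<nu> x = - (p * lommel_Q \<nu> n x)" using cas Q by (simp add: p_def)
    have "lommel_Q' \<nu> (Suc n) x * lommel_Q \<nu> n x < 0"
      using lommel_Q_wronskian_neg[OF assms(1,2), of i] unfolding Q[unfolded n] n by simp
    moreover have "p * p > 0" using False by (metis p_def not_real_square_gt_zero)
    ultimately have "(p * p) * (lommel_Q' \<nu> (Suc n) x * lommel_Q \<nu> n x) < 0"
      by (rule mult_pos_neg[rotated])
    moreover have "p * lommel_Q' \<nu> (Suc n) x * - (p * lommel_Q \<nu> n x)
        = - ((p * p) * (lommel_Q' \<nu> (Suc n) x * lommel_Q \<nu> n x))" by (simp only: mult_minus_right mult_ac)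
    ultimately have "p * lommel_Q' \<nu> (Suc n) x * - (p * lommel_Q \<nu> n x) > 0" by linarith
    then show ?thesis by (simp only: Q c p_def[symmetric] mult_zero_right add_0_left)
  qed
qed

subsection \<open>Interlacing\<close>

theorem theorem4p1:
  fixes \<alpha> \<nu> :: real and m :: nat
  assumes "0 \<le> \<alpha>" "\<alpha> < pi"
    and "\<nu> > 0"
    and "m \<ge> 1"
    and "common_zeros \<alpha> m \<nu> = {}"
  shows "0 < cylinder_zero \<alpha> \<nu> 1 \<and>
    (\<forall>k\<ge>1. cylinder_zero \<alpha> \<nu> k < tau \<alpha> m \<nu> k \<and> tau \<alpha> m \<nu> k < cylinder_zero \<alpha> \<nu> (k + 1))"
proof -
  obtain n where m: "m = Suc n" using assms(4) by (cases m) auto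
  have \<nu>: "\<nu> \<ge> 0" using assms(3) by simp
  define C where "C = cylinder \<alpha> \<nu>"
  define C' where "C' = (\<lambda>x. \<nu> / x * cylinder \<alpha> \<nu> x - cylinder \<alpha> (\<nu> + 1) x)"
  define G where "G = (\<lambda>x. cylinder \<alpha> (\<nu> + real m) x * lommel_Q \<nu> m x)"
  define G' where "G' = (\<lambda>x. (cylinder \<alpha> (\<nu> + real n) x
      - (\<nu> + real m) / x * cylinder \<alpha> (\<nu> + real m) x) * lommel_Q \<nu> m x
      + cylinder \<alpha> (\<nu> + real m) x * lommel_Q' \<nu> m x)"
  have C: "(C has_field_derivative C' x) (at x)" if "x > 0" for x
    unfolding C_def C'_def by (rule cylinder_has_derivative[OF \<nu> that])
  have G: "(G has_field_derivative G' x) (at x)" if "x > 0" for x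
  proof -
    have "(cylinder \<alpha> (\<nu> + real m) has_field_derivative cylinder \<alpha> (\<nu> + real n) x
        - (\<nu> + real m) / x * cylinder \<alpha> (\<nu> + real m) x) (at x)"
      using cylinder_has_derivative'[of "\<nu> + real n" x \<alpha>] \<nu> that by (simp add: m add_ac)
    from DERIV_mult[OF this lommel_Q_has_derivative[of x \<nu> m]] that show ?thesis
      unfolding G_def G'_def by (simp add: mult.commute)
  qed
  have up: "G' x * C x > 0" if "x > 0" "C x \<noteq> 0" "G x = 0" for x
    using that unfolding C_def G_def G'_def m
    by (rule cylinder_lommel_product_derivative_sign[OF \<nu>])
  obtain f :: "nat \<Rightarrow> real" where f: "strict_mono f" "range f = {x. x > 0 \<and> C x = 0}"
    using cylinder_zeros_enum[OF assms(1-3)] unfolding C_def by blast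
  \<comment> \<open>The enumeration \<open>f\<close> starts at index 0, the zeros are counted from
    1.\<close>
  have c: "cylinder_zero \<alpha> \<nu> k = f (k - 1)" for k
    unfolding cylinder_zero_def using incr_enum_eqI[OF f] by (simp add: C_def)
  have fz: "f k > 0" "C (f k) = 0" for k using f(2) by blast+
  have no_zero: "C x \<noteq> 0" if "f k < x" "x < f (Suc k)" for x k
  proof
    assume "C x = 0"
    then have "x \<in> range f" using that fz(1)[of k] f(2) by auto
    then obtain j where "x = f j" by blast
    then show False using that strict_mono_less[OF f(1)] by simp
  qed
  \<comment> \<open>At \<open>f k\<close> the product is minus a square, which is nonzero because
    \<open>C\<close> and the function of order \<open>\<nu> + m\<close> have no common zero.\<close>
  have ends: "C' (f k) * G (f k) < 0" for k
  proof -
    define p where "p = cylinder \<alpha> (\<nu> + 1) (f k)"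
    have "cylinder \<alpha> (\<nu> + real m) (f k) \<noteq> 0"
    proof
      assume "cylinder \<alpha> (\<nu> + real m) (f k) = 0"
      then have "cylinder_zero \<alpha> \<nu> (Suc k) \<in> common_zeros \<alpha> m \<nu>"
        unfolding common_zeros_def by (auto simp: c intro!: exI[of _ "Suc k"])
      then show False using assms(5) by simp
    qed
    moreover have e: "cylinder \<alpha> (\<nu> + real m) (f k) = p * lommel_Q \<nu> m (f k)"
      unfolding p_def using fz by (intro cylinder_eq_lommel_at_zero[OF \<nu>]) (auto simp: C_def)
    ultimately have "(p * lommel_Q \<nu> m (f k))\<^sup>2 > 0" by simp
    moreover have "C' (f k) * G (f k) = - (p * lommel_Q \<nu> m (f k))\<^sup>2"
      using fz(2)[of k] unfolding C'_def G_def e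
      by (simp add: C_def p_def power2_eq_square)
    ultimately show ?thesis by simp
  qed
  have "\<exists>!x. f k < x \<and> x < f (Suc k) \<and> G x = 0" for k
  proof (rule ex1_zero_between[where f = C and f' = C' and G' = G'])
    show "f k < f (Suc k)" using f(1) by (simp add: strict_mono_less)
    have pos: "x > 0" if "f k \<le> x" for x using that fz(1)[of k] by simp
    show "(C has_field_derivative C' x) (at x)" "(G has_field_derivative G' x) (at x)"
      if "f k \<le> x" for x using C[OF pos[OF that]] G[OF pos[OF that]] by auto
    show "G' x * C x > 0" if "f k < x" "x < f (Suc k)" "G x = 0" for x
      using up[OF pos no_zero[OF that(1,2)] that(3)] that by simp
  qed (use fz ends no_zero in auto)
  then obtain t where t: "\<And>k. f k < t k" "\<And>k. t k < f (Suc k)" "\<And>k. G (t k) = 0"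
    and t_unique: "\<And>k x. f k < x \<Longrightarrow> x < f (Suc k) \<Longrightarrow> G x = 0 \<Longrightarrow> x = t k"
    by metis
  have "strict_mono t"
    unfolding strict_mono_Suc_iff using t(1,2) less_trans by blast
  have first: "f 0 < x" if "x > 0" "G x = 0" for x
  proof (rule ccontr)
    assume "\<not> f 0 < x"
    moreover have "x \<noteq> f 0" using ends[of 0] that by auto
    ultimately have x: "x < f 0" by simp
    \<comment> \<open>A starting point left of \<open>x\<close> with \<open>G y > 0\<close>; the
      bound \<open>y < \<nu>\<close> makes \<open>lommel_Q_pos\<close> applicable.\<close>
    have "eventually (\<lambda>y. C y > 0 \<and> cylinder \<alpha> (\<nu> + real m) y > 0 \<and> 0 < y \<and> y < min \<nu> x) (at_right 0)"
      unfolding C_def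
      using cylinder_eventually_pos[OF assms(1-3)] cylinder_eventually_pos[OF assms(1,2), of "\<nu> + real m"]
        eventually_at_right_real[of 0 "min \<nu> x"] assms(3) that(1) by (auto simp: eventually_conj_iff)
    then obtain y where y: "C y > 0" "cylinder \<alpha> (\<nu> + real m) y > 0" "0 < y" "y < \<nu>" "y < x"
      using eventually_happens by fastforce
    have "C z \<noteq> 0" if "0 < z" "z < f 0" for z
    proof
      assume "C z = 0"
      then have "z \<in> range f" using that f(2) by simp
      then obtain j where "z = f j" by blast
      then show False using that strict_mono_less[OF f(1)] by simp
    qed
    moreover have "continuous_on {0<..<f 0} C"
      by (rule continuous_on_of_DERIV) (use C in auto)
    ultimately have Cpos: "C z > 0" if "0 < z" "z < f 0" for z
      using nonzero_same_sign[of 0 "f 0" C] y x that by force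
    have "G x > 0"
    proof (rule positive_of_upcrossing_zeros[where a = y and b = x and G = G and G' = G'])
      show "G y > 0" using y lommel_Q_pos[of y \<nu> n] by (simp add: G_def m)
      show "G' z > 0" if "y \<le> z" "z \<le> x" "G z = 0" for z
        using up[of z] Cpos[of z] that y x by (simp add: zero_less_mult_iff)
    qed (use y G in auto)
    then show False using that by simp
  qed
  have "x \<in> range t" if x: "x > 0" "G x = 0" for x
  proof -
    obtain y where "y > x" "C y = 0" using cylinder_zero_exists[OF \<nu>] unfolding C_def by blast
    then obtain j where j: "f j > x" using x f(2) by (metis (mono_tags, lifting) less_trans mem_Collect_eq rangeE)
    \<comment> \<open>The first zero of \<open>C\<close> beyond \<open>x\<close>. It is not
      \<open>f 0\<close> by \<open>first\<close>, so \<open>x\<close> lies between two consecutive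
      zeros and uniqueness identifies it with \<open>t i\<close>.\<close>
    define k where "k = (LEAST k. x < f k)"
    have k: "x < f k" unfolding k_def by (rule LeastI[of "\<lambda>k. x < f k", OF j])
    then obtain i where i: "k = Suc i" using first[OF x] by (cases k) auto
    then have "\<not> x < f i" using not_less_Least[of i "\<lambda>k. x < f k"] by (simp add: k_def)
    moreover have "x \<noteq> f i" using ends[of i] x by auto
    ultimately have "x = t i" using k i x by (intro t_unique) auto
    then show ?thesis by simp
  qed
  moreover have "t k > 0" for k using t(1)[of k] fz(1)[of k] by simp
  ultimately have "range t = {x. x > 0 \<and> G x = 0}" using t(3) by auto
  \<comment> \<open>The zero set of the product is the union of the zero sets of its
    factors.\<close>
  also have "\<dots> = {x. x > 0 \<and> cylinder \<alpha> (\<nu> + real m) x = 0}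
      \<union> {x. x > 0 \<and> lommel_R (m - 1) (\<nu> + 1) x = 0}"
    using lommel_R_eq_Q[OF assms(3)] by (auto simp: G_def m)
  finally have "tau \<alpha> m \<nu> k = t (k - 1)" for k
    unfolding tau_def using incr_enum_eqI[OF \<open>strict_mono t\<close>] by simp
  moreover have "t (k - 1) < f k" if "k \<ge> 1" for k using t(2)[of "k - 1"] that by simp
  ultimately show ?thesis using t(1) fz(1) by (simp add: c)
qed

end
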